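(* Assume $A\subseteq\omega$ is 1-generic. Then $A$ is quasiminimal in the nonuniform generic degrees.
   Context: A real is a subset of $\omega$, identified with its characteristic function. A real $X$ is density-1 if $\lim_{n\to\infty}|X\cap n|/n=1$. A real $A$ is 1-generic if for every $\Sigma^0_1$ set of strings $S\subseteq2^{<\omega}$, some initial segment of $A$ is in $S$ or some initial segment of $A$ has no extension in $S$. A (time-dependent) partial oracle $(A)$ for a real $A$ is a set of triples $\langle n,x,l\rangle$ with $n,l\in\omega$, $x\in\{0,1\}$, such that $\langle n,x,l\rangle\in(A)$ implies $A(n)=x$, and for every $n,x$ there is at most one $l$ with $\langle n,x,l\rangle\in(A)$. Its domain is the set of $n$ for which some $\langle n,x,l\rangle\in(A)$ exists. A Turing functional uses $(A)$ as an ordinary oracle for this set of triples. A generic oracle for $A$ is a partial oracle for $A$ with density-1 domain. A generic computation of $B$ is a (possibly oracle) partial computation $\psi$ with density-1 domain such that $\psi(n)=B(n)$ whenever $\psi(n)\downarrow$; $B$ is generically computable if it has a generic computation without oracle. $B\leq_{\mathrm{ng}}A$ ($B$ is nonuniformly generically reducible to $A$) if for every generic oracle $(A)$ for $A$ there exists a Turing functional $\phi$ (which may depend on $(A)$) such that $\phi^{(A)}$ is a generic computation of $B$. For $X\subseteq\omega$ let $\mathcal{R}(X)=\{(2m+1)2^n:m\in\omega,\ n\in X\}$ and $\widetilde{\mathcal{R}}(X)=\{m:(\exists n\in X)(2^n\leq m<2^{n+1})\}$. The map $X\mapsto\widetilde{\mathcal{R}}(\mathcal{R}(X))$ induces an embedding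 of the Turing degrees into the nonuniform generic degrees. A real $A$ is quasiminimal in the nonuniform generic degrees if $A$ is not generically computable and $\widetilde{\mathcal{R}}(\mathcal{R}(B))\nleq_{\mathrm{ng}}A$ for every noncomputable $B$. *)

theory Defs
  imports Complex_Main "HOL-Library.Nat_Bijection" "HOL-Library.Sublist"
begin

section \<open>Partial recursive functionals with a set oracle\<close>

text \<open>
  The model of relative computation is Kleene's: the functions computable by an oracle Turing
  machine with oracle \<open>X\<close> are those obtained from the basic functions and the characteristic
  function of \<open>X\<close> by composition, primitive recursion and unbounded search. A term is a
  program that does not mention a particular oracle, so it plays the role of a Turing functional.
\<close>

datatype recfun =
    Zero
  | Succ
  | Proj nat
  | Query
  | Comp recfun "recfun list"
  | PrimRec recfun recfun
  | Mu recfun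

definition chi :: "nat set \<Rightarrow> nat \<Rightarrow> nat" where
  "chi A n = of_bool (n \<in> A)"

text \<open>
  \<open>eval X f xs v\<close>: on arguments \<open>xs\<close> with oracle \<open>X\<close>, the program \<open>f\<close> halts with value
  \<open>v\<close>. Arities are not recorded in the syntax: a basic function applied to too few arguments does not
  halt, and superfluous arguments are ignored.
\<close>

inductive eval :: "nat set \<Rightarrow> recfun \<Rightarrow> nat list \<Rightarrow> nat \<Rightarrow> bool" for X where
  eval_Zero: "eval X Zero xs 0"
| eval_Succ: "eval X Succ (x # xs) (Suc x)"
| eval_Proj: "i < length xs \<Longrightarrow> eval X (Proj i) xs (xs ! i)"
| eval_Query: "eval X Query (x # xs) (chi X x)"
| eval_Comp: "list_all2 (\<lambda>g y. eval X g xs y) gs ys \<Longrightarrow> eval X f ys v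
    \<Longrightarrow> eval X (Comp f gs) xs v"
| eval_PrimRec_0: "eval X f xs v \<Longrightarrow> eval X (PrimRec f g) (0 # xs) v"
| eval_PrimRec_Suc: "eval X (PrimRec f g) (n # xs) u \<Longrightarrow> eval X g (n # u # xs) v
    \<Longrightarrow> eval X (PrimRec f g) (Suc n # xs) v"
| eval_Mu: "eval X f (y # xs) 0 \<Longrightarrow> (\<forall>z<y. \<exists>w. eval X f (z # xs) (Suc w))
    \<Longrightarrow> eval X (Mu f) xs y"

inductive_cases eval_ZeroE: "eval X Zero xs v"
inductive_cases eval_SuccE: "eval X Succ xs v"
inductive_cases eval_ProjE: "eval X (Proj i) xs v"
inductive_cases eval_QueryE: "eval X Query xs v"
inductive_cases eval_CompE: "eval X (Comp f gs) xs v"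
inductive_cases eval_PrimRec_0E: "eval X (PrimRec f g) (0 # xs) v"
inductive_cases eval_PrimRec_SucE: "eval X (PrimRec f g) (Suc n # xs) v"
inductive_cases eval_MuE: "eval X (Mu f) xs v"

lemma eval_deterministic: "eval X f xs v \<Longrightarrow> eval X f xs w \<Longrightarrow> w = v"
proof (induction arbitrary: w rule: eval.induct)
  case (eval_Comp xs gs ys f v)
  from eval_Comp.prems obtain zs where
    zs: "list_all2 (\<lambda>g y. eval X g xs y) gs zs" "eval X f zs w"
    by (rule eval_CompE)
  have "zs ! i = ys ! i" if "i < length gs" for i
    using list_all2_nthD[OF eval_Comp.IH(1) that] list_all2_nthD[OF zs(1) that] by blast
  moreover have "length zs = length gs" "length ys = length gs"
    using list_all2_lengthD[OF zs(1)] list_all2_lengthD[OF eval_Comp.IH(1)] by simp_all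
  ultimately have "zs = ys"
    by (simp add: list_eq_iff_nth_eq)
  with eval_Comp.IH(2) zs(2) show ?case by blast
next
  case (eval_PrimRec_Suc f g n xs u v)
  from eval_PrimRec_Suc.prems obtain u' where
    "eval X (PrimRec f g) (n # xs) u'" "eval X g (n # u' # xs) w"
    by (rule eval_PrimRec_SucE)
  with eval_PrimRec_Suc.IH show ?case by blast
next
  case (eval_PrimRec_0 f xs v g)
  from eval_PrimRec_0.prems have "eval X f xs w"
    by (rule eval_PrimRec_0E)
  with eval_PrimRec_0.IH show ?case by blast
next
  case (eval_Mu f y xs)
  from eval_Mu.prems have w: "eval X f (w # xs) 0" "\<forall>z<w. \<exists>u. eval X f (z # xs) (Suc u)"
    by (auto elim: eval_MuE)
  have "\<not> w < y"
    using eval_Mu.IH(2) w(1) by (meson nat.distinct(1))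
  moreover have "\<not> y < w"
    using eval_Mu.IH(1) w(2) nat.distinct(1) by metis
  ultimately show ?case by simp
qed (erule eval_ZeroE eval_SuccE eval_ProjE eval_QueryE; simp)+

definition functional :: "recfun \<Rightarrow> nat set \<Rightarrow> (nat \<rightharpoonup> nat)" where
  "functional f X n = (if \<exists>v. eval X f [n] v then Some (THE v. eval X f [n] v) else None)"

lemma functional_eq_Some_iff: "functional f X n = Some v \<longleftrightarrow> eval X f [n] v"
proof -
  have "(THE v. eval X f [n] v) = u" if "eval X f [n] u" for u
    using that eval_deterministic by blast
  then show ?thesis
    unfolding functional_def using eval_deterministic by auto
qed

text \<open>Computing without an oracle is computing with the oracle \<open>{}\<close>.\<close>

definition computable :: "nat set \<Rightarrow> bool" where
  "computable B \<longleftrightarrow> (\<exists>f. \<forall>n. functional f {} n = Some (chi B n))"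

definition computable_rel :: "(nat \<Rightarrow> nat \<Rightarrow> bool) \<Rightarrow> bool" where
  "computable_rel R \<longleftrightarrow> (\<exists>f. \<forall>x y. eval {} f [x, y] (of_bool (R x y)))"


section \<open>1-generic reals\<close>

definition string_code :: "bool list \<Rightarrow> nat" where
  "string_code \<sigma> = list_encode (map of_bool \<sigma>)"

definition Sigma01_strings :: "bool list set \<Rightarrow> bool" where
  "Sigma01_strings S \<longleftrightarrow>
     (\<exists>R. computable_rel R \<and> S = {\<sigma>. \<exists>y. R (string_code \<sigma>) y})"

definition initial_segment :: "nat set \<Rightarrow> nat \<Rightarrow> bool list" where
  "initial_segment A k = map (\<lambda>i. i \<in> A) [0..<k]"

definition one_generic :: "nat set \<Rightarrow> bool" where
  "one_generic A \<longleftrightarrow>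
     (\<forall>S. Sigma01_strings S \<longrightarrow>
        (\<exists>k. initial_segment A k \<in> S) \<or>
        (\<exists>k. \<forall>\<tau>. prefix (initial_segment A k) \<tau> \<longrightarrow> \<tau> \<notin> S))"


section \<open>Generic oracles and nonuniform generic reducibility\<close>

definition density_1 :: "nat set \<Rightarrow> bool" where
  "density_1 X \<longleftrightarrow> (\<lambda>n. real (card (X \<inter> {..<n})) / real n) \<longlonglongrightarrow> 1"

definition partial_oracle :: "nat set \<Rightarrow> (nat \<times> nat \<times> nat) set \<Rightarrow> bool" where
  "partial_oracle A P \<longleftrightarrow>
     (\<forall>n x l. (n, x, l) \<in> P \<longrightarrow> x \<in> {0, 1} \<and> chi A n = x) \<and>
     (\<forall>n x l l'. (n, x, l) \<in> P \<longrightarrow> (n, x, l') \<in> P \<longrightarrow> l = l')"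

definition oracle_dom :: "(nat \<times> nat \<times> nat) set \<Rightarrow> nat set" where
  "oracle_dom P = {n. \<exists>x l. (n, x, l) \<in> P}"

definition generic_oracle :: "nat set \<Rightarrow> (nat \<times> nat \<times> nat) set \<Rightarrow> bool" where
  "generic_oracle A P \<longleftrightarrow> partial_oracle A P \<and> density_1 (oracle_dom P)"

definition triples_code :: "(nat \<times> nat \<times> nat) set \<Rightarrow> nat set" where
  "triples_code P = {prod_encode (n, prod_encode (x, l)) | n x l. (n, x, l) \<in> P}"

definition generic_computation :: "(nat \<rightharpoonup> nat) \<Rightarrow> nat set \<Rightarrow> bool" where
  "generic_computation \<psi> B \<longleftrightarrow>
     density_1 (dom \<psi>) \<and> (\<forall>n v. \<psi> n = Some v \<longrightarrow> v = chi B n)"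

definition generically_computable :: "nat set \<Rightarrow> bool" where
  "generically_computable B \<longleftrightarrow> (\<exists>f. generic_computation (functional f {}) B)"

definition ng_reducible :: "nat set \<Rightarrow> nat set \<Rightarrow> bool" (infix \<open>\<le>\<^sub>n\<^sub>g\<close> 50) where
  "B \<le>\<^sub>n\<^sub>g A \<longleftrightarrow>
     (\<forall>P. generic_oracle A P \<longrightarrow>
        (\<exists>f. generic_computation (functional f (triples_code P)) B))"

definition RR :: "nat set \<Rightarrow> nat set" where
  "RR X = {(2 * m + 1) * 2 ^ n | m n. n \<in> X}"

definition RR_tilde :: "nat set \<Rightarrow> nat set" where
  "RR_tilde X = {m. \<exists>n\<in>X. 2 ^ n \<le> m \<and> m < 2 ^ (n + 1)}"

definition ng_quasiminimal :: "nat set \<Rightarrow> bool" where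
  "ng_quasiminimal A \<longleftrightarrow>
     \<not> generically_computable A \<and>
     (\<forall>B. \<not> computable B \<longrightarrow> \<not> RR_tilde (RR B) \<le>\<^sub>n\<^sub>g A)"

end

theory Submission
  imports Defs "HOL-Library.Countable"
begin

text \<open>
  Given a noncomputable \<open>B\<close>, a generic oracle for \<open>A\<close> is built by finite extensions, defeating one
  functional \<open>f\<close> at each stage. If some finite partial oracle for \<open>A\<close> extending the current one makes
  \<open>f\<close> give a wrong answer, then it is adopted. Otherwise \<open>f\<close> must be prevented from answering: it
  suffices to find \<open>n\<close>, a residue class modulo \<open>2 ^ e\<close> and a bound \<open>L\<close> such that \<open>f\<close> cannot decide
  \<open>n \<in> B\<close> from any partial oracle that hides this class below \<open>L\<close>. If this were impossible, \<open>f\<close>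
  would decide \<open>B\<close> with any one class hidden up to any bound. By 1-genericity, applied once per
  class, the classes could then be replaced one after the other by arbitrary bits without ever
  producing a wrong answer, so that \<open>B\<close> could be computed by simulating \<open>f\<close> on arbitrary strings that
  extend a fixed initial segment of \<open>A\<close>. The hidden classes become sparser from stage to stage, so
  the domain has density 1.
\<close>

section \<open>Total recursive functions\<close>

definition recursive :: "nat \<Rightarrow> (nat list \<Rightarrow> nat) \<Rightarrow> bool" where
  "recursive k F \<longleftrightarrow> (\<exists>p. \<forall>xs. length xs = k \<longrightarrow> eval {} p xs (F xs))"

definition decidable :: "nat \<Rightarrow> (nat list \<Rightarrow> bool) \<Rightarrow> bool" where
  "decidable k Q \<longleftrightarrow> recursive k (\<lambda>xs. of_bool (Q xs))"

lemma recursive_cong: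
  assumes "recursive k F" "\<And>xs. length xs = k \<Longrightarrow> F xs = G xs"
  shows "recursive k G"
  using assms unfolding recursive_def by metis

lemma recursive_proj: "i < k \<Longrightarrow> recursive k (\<lambda>xs. xs ! i)"
  unfolding recursive_def by (metis eval_Proj)

text \<open>The inner functions are packed into one list-valued \<open>H\<close>, given by its
  components, so that later proofs can drop, prepend or permute arguments by describing the new
  argument list.\<close>

lemma recursive_subst:
  assumes F: "recursive k' F"
    and H: "\<And>i. i < k' \<Longrightarrow> recursive k (\<lambda>xs. H xs ! i)"
    and len: "\<And>xs. length xs = k \<Longrightarrow> length (H xs) = k'"
  shows "recursive k (\<lambda>xs. F (H xs))"
proof -
  obtain p where p: "\<And>xs. length xs = k' \<Longrightarrow> eval {} p xs (F xs)"
    using F unfolding recursive_def by blast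
  have "\<forall>i. \<exists>q. i < k' \<longrightarrow> (\<forall>xs. length xs = k \<longrightarrow> eval {} q xs (H xs ! i))"
    using H unfolding recursive_def by blast
  then obtain q where q: "\<And>i xs. i < k' \<Longrightarrow> length xs = k \<Longrightarrow> eval {} (q i) xs (H xs ! i)"
    by metis
  have "eval {} (Comp p (map q [0..<k'])) xs (F (H xs))" if "length xs = k" for xs
  proof (rule eval_Comp)
    show "list_all2 (\<lambda>g y. eval {} g xs y) (map q [0..<k']) (H xs)"
      using q that len[OF that] by (auto simp: list_all2_conv_all_nth)
    show "eval {} p (H xs) (F (H xs))"
      using p len[OF that] by blast
  qed
  then show ?thesis unfolding recursive_def by blast
qed

lemma recursive_comp1:
  assumes "recursive 1 (\<lambda>xs. h (xs ! 0))" "recursive k F"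
  shows "recursive k (\<lambda>xs. h (F xs))"
  using recursive_subst[OF assms(1), of k "\<lambda>xs. [F xs]"] assms(2) by simp

lemma recursive_comp2:
  assumes "recursive 2 (\<lambda>xs. h (xs ! 0) (xs ! 1))" "recursive k F" "recursive k G"
  shows "recursive k (\<lambda>xs. h (F xs) (G xs))"
proof -
  have "recursive k (\<lambda>xs. [F xs, G xs] ! i)" if "i < 2" for i
    using that assms(2,3) by (cases i) auto
  from recursive_subst[OF assms(1) this] show ?thesis by simp
qed

lemma recursive_Suc: "recursive k F \<Longrightarrow> recursive k (\<lambda>xs. Suc (F xs))"
proof (rule recursive_comp1[of "Suc"])
  have "eval {} Succ xs (Suc (xs ! 0))" if "length xs = 1" for xs
    using that eval_Succ by (cases xs) auto
  then show "recursive 1 (\<lambda>xs. Suc (xs ! 0))"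
    unfolding recursive_def by blast
qed

lemma recursive_const: "recursive k (\<lambda>xs. c)"
proof (induction c)
  case 0
  show ?case unfolding recursive_def using eval_Zero by blast
qed (rule recursive_Suc)

lemma recursive_proj_drop:
  assumes "j + i < k"
  shows "recursive k (\<lambda>xs. drop j xs ! i)"
  by (rule recursive_cong[OF recursive_proj[OF assms]]) (use assms in simp)

text \<open>\<open>PrimRec\<close> hands its step program the counter and the previous value in
  front of the parameters; hence the parameters appear as \<open>drop 2 ys\<close>.\<close>

lemma recursive_rec_nat:
  assumes st: "recursive (Suc (Suc k)) (\<lambda>ys. st (ys ! 0) (ys ! 1) (drop 2 ys))"
    and b: "recursive k b" and N: "recursive k N"
  shows "recursive k (\<lambda>xs. rec_nat (b xs) (\<lambda>i u. st i u xs) (N xs))"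
proof -
  obtain pb ps where pb: "\<And>xs. length xs = k \<Longrightarrow> eval {} pb xs (b xs)"
    and ps: "\<And>ys. length ys = Suc (Suc k) \<Longrightarrow> eval {} ps ys (st (ys ! 0) (ys ! 1) (drop 2 ys))"
    using b st unfolding recursive_def by blast
  have "eval {} (PrimRec pb ps) (n # xs) (rec_nat (b xs) (\<lambda>i u. st i u xs) n)"
    if "length xs = k" for n xs
  proof (induction n)
    case 0
    show ?case using pb[OF that] by (simp add: eval_PrimRec_0)
  next
    case (Suc n)
    show ?case
      by (rule eval_PrimRec_Suc[OF Suc]) (use ps[of "n # u # xs" for u] that in simp)
  qed
  then have "eval {} (PrimRec pb ps) xs (rec_nat (b (tl xs)) (\<lambda>i u. st i u (tl xs)) (hd xs))"
    if "length xs = Suc k" for xs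
    using that by (cases xs) auto
  then have *: "recursive (Suc k) (\<lambda>xs. rec_nat (b (tl xs)) (\<lambda>i u. st i u (tl xs)) (hd xs))"
    unfolding recursive_def by blast
  have "recursive k (\<lambda>xs. (N xs # xs) ! i)" if "i < Suc k" for i
    using that N by (cases i) (auto intro: recursive_proj)
  from recursive_subst[OF * this] show ?thesis by simp
qed

lemma recursive_drop2:
  assumes "recursive k F"
  shows "recursive (Suc (Suc k)) (\<lambda>xs. F (drop 2 xs))"
  by (rule recursive_subst[OF assms]) (auto intro: recursive_proj_drop)

text \<open>A recursion on \<open>c xs\<close> whose step ignores both counter and previous value
  acts as a case distinction.\<close>

lemma recursive_if0:
  assumes "recursive k c" "recursive k a" "recursive k b"
  shows "recursive k (\<lambda>xs. if c xs = 0 then a xs else b xs)"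
proof (rule recursive_cong)
  show "recursive k (\<lambda>xs. rec_nat (a xs) (\<lambda>i u. b xs) (c xs))"
    by (intro recursive_rec_nat recursive_drop2 assms)
  show "rec_nat (a xs) (\<lambda>i u. b xs) (c xs) = (if c xs = 0 then a xs else b xs)" for xs
    by (cases "c xs") auto
qed

lemma recursive_pred: "recursive k F \<Longrightarrow> recursive k (\<lambda>xs. F xs - 1)"
proof (erule recursive_comp1[of "\<lambda>x. x - 1", rotated], rule recursive_cong)
  show "recursive 1 (\<lambda>xs. rec_nat 0 (\<lambda>i u. i) (xs ! 0))"
    by (intro recursive_rec_nat recursive_const recursive_proj recursive_proj_drop) auto
  show "rec_nat 0 (\<lambda>i u. i) (xs ! 0) = xs ! 0 - 1" for xs :: "nat list"
    by (cases "xs ! 0") auto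
qed

lemma recursive_add: "recursive k F \<Longrightarrow> recursive k G \<Longrightarrow> recursive k (\<lambda>xs. F xs + G xs)"
proof (erule recursive_comp2[of "(+)", rotated], assumption, rule recursive_cong)
  show "recursive 2 (\<lambda>xs. rec_nat (xs ! 1) (\<lambda>i u. Suc (u)) (xs ! 0))"
    by (intro recursive_rec_nat recursive_Suc recursive_proj recursive_proj_drop) auto
  have "rec_nat b (\<lambda>i u. Suc u) a = a + b" for a b :: nat
    by (induction a) auto
  then show "rec_nat (xs ! 1) (\<lambda>i u. Suc (u)) (xs ! 0) = xs ! 0 + xs ! 1"
    for xs :: "nat list"
    by simp
qed

lemma recursive_diff: "recursive k F \<Longrightarrow> recursive k G \<Longrightarrow> recursive k (\<lambda>xs. F xs - G xs)"
proof (erule recursive_comp2[of "(-)", rotated], assumption, rule recursive_cong)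
  show "recursive 2 (\<lambda>xs. rec_nat (xs ! 0) (\<lambda>i u. u - 1) (xs ! 1))"
    by (intro recursive_rec_nat recursive_pred recursive_proj recursive_proj_drop) auto
  have "rec_nat a (\<lambda>i u. u - 1) b = a - b" for a b :: nat
    by (induction b) auto
  then show "rec_nat (xs ! 0) (\<lambda>i u. u - 1) (xs ! 1) = xs ! 0 - xs ! 1"
    for xs :: "nat list"
    by simp
qed

lemma recursive_mult: "recursive k F \<Longrightarrow> recursive k G \<Longrightarrow> recursive k (\<lambda>xs. F xs * G xs)"
proof (erule recursive_comp2[of "(*)", rotated], assumption, rule recursive_cong)
  show "recursive 2 (\<lambda>xs. rec_nat 0 (\<lambda>i u. u + xs ! 1) (xs ! 0))"
    by (intro recursive_rec_nat recursive_add recursive_const recursive_proj recursive_proj_drop) auto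
  have "rec_nat 0 (\<lambda>i u. u + b) a = a * b" for a b :: nat
    by (induction a) auto
  then show "rec_nat 0 (\<lambda>i u. u + xs ! 1) (xs ! 0) = xs ! 0 * xs ! 1"
    for xs :: "nat list"
    by simp
qed

lemma recursive_pow2: "recursive k F \<Longrightarrow> recursive k (\<lambda>xs. 2 ^ F xs)"
proof (erule recursive_comp1[of "(^) 2", rotated], rule recursive_cong)
  show "recursive 1 (\<lambda>xs. rec_nat 1 (\<lambda>i u. 2 * u) (xs ! 0))"
    by (intro recursive_rec_nat recursive_mult recursive_const recursive_proj recursive_proj_drop) auto
  have "rec_nat 1 (\<lambda>i u. 2 * u) n = (2 ^ n :: nat)" for n
    by (induction n) auto
  then show "rec_nat 1 (\<lambda>i u. 2 * u) (xs ! 0) = (2 ^ (xs ! 0) :: nat)" for xs :: "nat list"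
    by simp
qed

section \<open>Decidable predicates\<close>

lemma decidable_eq0: "recursive k F \<Longrightarrow> decidable k (\<lambda>xs. F xs = 0)"
  unfolding decidable_def of_bool_def by (intro recursive_if0 recursive_const)

lemma recursive_if:
  assumes "decidable k Q" "recursive k a" "recursive k b"
  shows "recursive k (\<lambda>xs. if Q xs then a xs else b xs)"
  by (rule recursive_cong[OF recursive_if0[OF assms(1)[unfolded decidable_def] assms(3,2)]]) auto

lemma decidable_not: "decidable k Q \<Longrightarrow> decidable k (\<lambda>xs. \<not> Q xs)"
  using decidable_eq0[of k "\<lambda>xs. of_bool (Q xs)"] by (simp add: decidable_def)

lemma decidable_conj:
  "decidable k Q \<Longrightarrow> decidable k R \<Longrightarrow> decidable k (\<lambda>xs. Q xs \<and> R xs)"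
  using recursive_mult[of k "\<lambda>xs. of_bool (Q xs)" "\<lambda>xs. of_bool (R xs)"]
  by (simp add: decidable_def of_bool_conj)

lemma decidable_disj:
  "decidable k Q \<Longrightarrow> decidable k R \<Longrightarrow> decidable k (\<lambda>xs. Q xs \<or> R xs)"
  using decidable_not[OF decidable_conj[OF decidable_not decidable_not]] by simp

lemma decidable_le:
  "recursive k F \<Longrightarrow> recursive k G \<Longrightarrow> decidable k (\<lambda>xs. F xs \<le> G xs)"
  using decidable_eq0[OF recursive_diff] by simp

lemma decidable_less:
  "recursive k F \<Longrightarrow> recursive k G \<Longrightarrow> decidable k (\<lambda>xs. F xs < G xs)"
  using decidable_not[OF decidable_le] by (simp add: not_le)

lemma decidable_eq:
  "recursive k F \<Longrightarrow> recursive k G \<Longrightarrow> decidable k (\<lambda>xs. F xs = G xs)"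
  using decidable_conj[OF decidable_le decidable_le] by (simp add: eq_iff)

lemma decidable_const: "decidable k (\<lambda>xs. c)"
  unfolding decidable_def by (rule recursive_const)

lemma decidable_finite_set:
  assumes "finite S" "recursive k F"
  shows "decidable k (\<lambda>xs. F xs \<in> S)"
  using assms(1)
proof induction
  case empty
  show ?case using decidable_const by simp
next
  case (insert a S)
  show ?case
    using decidable_disj[OF decidable_eq[OF assms(2) recursive_const] insert.IH] by simp
qed

lemma recursive_mod:
  assumes "0 < M"
  shows "recursive k F \<Longrightarrow> recursive k (\<lambda>xs. F xs mod M)"
proof (erule recursive_comp1[of "\<lambda>x. x mod M", rotated], rule recursive_cong)
  \<comment> \<open>A counter that returns to 0 on reaching \<open>M\<close>.\<close>
  show "recursive 1 (\<lambda>xs. rec_nat 0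
      (\<lambda>i u. if Suc (u) = M then 0 else Suc (u)) (xs ! 0))"
    by (intro recursive_rec_nat recursive_if decidable_eq recursive_Suc recursive_const
        recursive_proj recursive_proj_drop) auto
  have "rec_nat 0 (\<lambda>i u. if Suc u = M then 0 else Suc u) n = n mod M" for n
    using assms by (induction n) (auto simp: mod_Suc)
  then show "rec_nat 0 (\<lambda>i u. if Suc (u) = M then 0 else Suc (u))
      (xs ! 0) = xs ! 0 mod M" for xs :: "nat list"
    by simp
qed

lemmas recursive_intros =
  recursive_proj recursive_proj_drop recursive_Suc recursive_const recursive_add recursive_diff recursive_mult
  recursive_pow2 recursive_if recursive_mod
  decidable_not decidable_conj decidable_disj decidable_le decidable_less decidable_eq
  decidable_const decidable_finite_set

section \<open>Recursive decoding of pairs and lists\<close>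

lemma recursive_triangle: "recursive k F \<Longrightarrow> recursive k (\<lambda>xs. triangle (F xs))"
proof (erule recursive_comp1[of "triangle", rotated], rule recursive_cong)
  show "recursive 1 (\<lambda>xs. rec_nat 0 (\<lambda>i u. u + Suc (i)) (xs ! 0))"
    by (intro recursive_rec_nat recursive_intros) auto
  have "rec_nat 0 (\<lambda>i u. u + Suc i) n = triangle n" for n
    by (induction n) auto
  then show "rec_nat 0 (\<lambda>i u. u + Suc (i)) (xs ! 0) =
      triangle (xs ! 0)" for xs :: "nat list"
    by simp
qed

text \<open>A code \<open>z\<close> of a pair lies on the diagonal whose index is the largest \<open>w\<close> with
  \<open>triangle w \<le> z\<close>.\<close>

definition diag :: "nat \<Rightarrow> nat" where
  "diag z = rec_nat 0 (\<lambda>i u. if triangle (Suc u) \<le> Suc i then Suc u else u) z"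

lemma diag_bounds: "triangle (diag z) \<le> z \<and> z < triangle (Suc (diag z))"
  by (induction z) (auto simp: diag_def)

lemma triangle_mono: "a \<le> b \<Longrightarrow> triangle a \<le> triangle b"
  by (induction rule: dec_induct) auto

lemma diag_prod_encode: "diag (prod_encode (a, b)) = a + b"
proof -
  let ?z = "prod_encode (a, b)"
  have z: "triangle (a + b) \<le> ?z" "?z < triangle (Suc (a + b))"
    by (auto simp: prod_encode_def)
  have "\<not> diag ?z < a + b"
    using z(1) diag_bounds[of ?z] triangle_mono[of "Suc (diag ?z)" "a + b"] by linarith
  moreover have "\<not> a + b < diag ?z"
    using z(2) diag_bounds[of ?z] triangle_mono[of "Suc (a + b)" "diag ?z"] by linarith
  ultimately show ?thesis by simp
qed

lemma recursive_diag: "recursive k F \<Longrightarrow> recursive k (\<lambda>xs. diag (F xs))"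
proof (erule recursive_comp1[of "diag", rotated], rule recursive_cong)
  show "recursive 1 (\<lambda>xs. rec_nat 0 (\<lambda>i u. if triangle (Suc (u)) \<le>
      Suc (i) then Suc (u) else u) (xs ! 0))"
    by (intro recursive_rec_nat recursive_intros recursive_triangle) auto
qed (simp add: diag_def del: triangle_Suc)

text \<open>Since \<open>prod_encode (a, b) = triangle (a + b) + a\<close>, both components follow
  from the diagonal by subtraction. This reduces decoding to arithmetic that is easily shown
  recursive.\<close>

lemma prod_decode_diag:
  "fst (prod_decode z) = z - triangle (diag z)"
  "snd (prod_decode z) = diag z - (z - triangle (diag z))"
proof -
  obtain a b where z: "z = prod_encode (a, b)"
    by (metis prod_decode_inverse surj_pair)
  show "fst (prod_decode z) = z - triangle (diag z)"
    "snd (prod_decode z) = diag z - (z - triangle (diag z))"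
    unfolding z diag_prod_encode prod_encode_inverse by (simp_all add: prod_encode_def)
qed

lemma recursive_fst: "recursive k F \<Longrightarrow> recursive k (\<lambda>xs. fst (prod_decode (F xs)))"
  and recursive_snd: "recursive k F \<Longrightarrow> recursive k (\<lambda>xs. snd (prod_decode (F xs)))"
  unfolding prod_decode_diag by (intro recursive_intros recursive_triangle recursive_diag; simp)+

lemmas recursive_pair_intros = recursive_intros recursive_fst recursive_snd

text \<open>Entries are shifted by one so that 0 can signal a position beyond the end of the
  list.\<close>

definition lookup :: "nat \<Rightarrow> nat \<Rightarrow> nat" where
  "lookup c x = (if x < length (list_decode c) then Suc (list_decode c ! x) else 0)"

lemma lookup_list_encode: "lookup (list_encode xs) x = (if x < length xs then Suc (xs ! x) else 0)"
  by (simp add: lookup_def)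

lemma recursive_lookup:
  "recursive k F \<Longrightarrow> recursive k G \<Longrightarrow> recursive k (\<lambda>xs. lookup (F xs) (G xs))"
proof (erule recursive_comp2[of "lookup", rotated], assumption, rule recursive_cong)
  \<comment> \<open>\<open>?d c x\<close> codes the list with its first \<open>x\<close> entries
    removed: a nonempty list has as code the successor of the code of the pair of its head and its
    coded tail.\<close>
  let ?d = "\<lambda>c x. rec_nat c (\<lambda>i u. snd (prod_decode (u - 1))) x"
  have "recursive 2 (\<lambda>xs. rec_nat (xs ! 0) (\<lambda>i u. snd (prod_decode (u - 1))) (xs ! 1))"
    by (intro recursive_rec_nat recursive_pair_intros) auto
  then have d: "recursive 2 (\<lambda>xs. ?d (xs ! 0) (xs ! 1))" by simp
  show "recursive 2 (\<lambda>xs. if ?d (xs ! 0) (xs ! 1) = 0 then 0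
      else Suc (fst (prod_decode (?d (xs ! 0) (xs ! 1) - 1))))"
    by (intro recursive_pair_intros d)
  \<comment> \<open>The code 0 of the empty list yields itself as tail, because
    \<open>0 - 1 = 0\<close> decodes to \<open>(0, 0)\<close>; so iterating past the end stays at
    0.\<close>
  have zero: "prod_decode 0 = (0, 0)"
    using prod_encode_inverse[of "(0, 0)"] by (simp add: prod_encode_def)
  have drop: "?d (list_encode ys) x = list_encode (drop x ys)" for ys x
  proof (induction x)
    case (Suc x)
    have "snd (prod_decode (list_encode zs - 1)) = list_encode (tl zs)" for zs
      using zero by (cases zs) auto
    then show ?case using Suc by (simp add: drop_Suc tl_drop)
  qed simp
  have "(if ?d c x = 0 then 0 else Suc (fst (prod_decode (?d c x - 1)))) = lookup c x" for c x
  proof -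
    define ys where "ys = list_decode c"
    have c: "c = list_encode ys" by (simp add: ys_def)
    show ?thesis
      unfolding c drop lookup_list_encode
      by (cases "x < length ys") (auto simp: Cons_nth_drop_Suc[symmetric])
  qed
  then show "(if ?d (xs ! 0) (xs ! 1) = 0 then 0
      else Suc (fst (prod_decode (?d (xs ! 0) (xs ! 1) - 1)))) = lookup (xs ! 0) (xs ! 1)"
    for xs :: "nat list" .
qed

section \<open>Evaluation with bounded search\<close>

text \<open>The value is \<open>0\<close> for a computation that does not halt when every unbounded search is cut off
  at \<open>t\<close>, and one more than the result otherwise. The state of a search is \<open>0\<close> while it is
  running, \<open>1\<close> after it has run into a computation that does not halt, and \<open>y + 2\<close> when it has
  found \<open>y\<close>.\<close>

fun run :: "(nat \<Rightarrow> nat) \<Rightarrow> nat \<Rightarrow> recfun \<Rightarrow> nat list \<Rightarrow> nat" where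
  "run h t Zero xs = 1"
| "run h t Succ xs = (if xs = [] then 0 else Suc (Suc (xs ! 0)))"
| "run h t (Proj i) xs = (if i < length xs then Suc (xs ! i) else 0)"
| "run h t Query xs = (if xs = [] then 0 else Suc (h (xs ! 0)))"
| "run h t (Comp f gs) xs =
    (if 0 \<in> set (map (\<lambda>g. run h t g xs) gs) then 0
     else run h t f (map (\<lambda>y. y - 1) (map (\<lambda>g. run h t g xs) gs)))"
| "run h t (PrimRec f g) xs =
    (if xs = [] then 0
     else rec_nat (run h t f (tl xs))
       (\<lambda>i u. if u = 0 then 0 else run h t g (i # (u - 1) # tl xs)) (xs ! 0))"
| "run h t (Mu f) xs =
    rec_nat 0 (\<lambda>z u. if u \<noteq> 0 then u
       else if run h t f (z # xs) = 0 then 1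
       else if run h t f (z # xs) = 1 then Suc (Suc z) else 0) t - 1"

text \<open>Cutting off searches can only lose results: by induction on the program, every nonzero
  value is genuine, whatever the cut-off \<open>t\<close>.\<close>

lemma run_sound: "run (chi X) t f xs = Suc v \<Longrightarrow> eval X f xs v"
proof (induction f arbitrary: xs v)
  case Zero
  then show ?case using eval_Zero by auto
next
  case Succ
  then show ?case using eval_Succ by (cases xs) auto
next
  case (Proj i)
  then show ?case using eval_Proj by (auto split: if_splits)
next
  case Query
  then show ?case using eval_Query by (cases xs) auto
next
  case (Comp f gs)
  let ?ys = "map (\<lambda>y. y - 1) (map (\<lambda>g. run (chi X) t g xs) gs)"
  have nz: "0 \<notin> set (map (\<lambda>g. run (chi X) t g xs) gs)" and r: "run (chi X) t f ?ys = Suc v"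
    using Comp.prems by (auto split: if_splits)
  have "eval X g xs (run (chi X) t g xs - 1)" if "g \<in> set gs" for g
    using nz that by (intro Comp.IH(2)) force+
  then have "list_all2 (\<lambda>g y. eval X g xs y) gs ?ys"
    by (auto simp: list_all2_conv_all_nth)
  then show ?case using Comp.IH(1)[OF r] by (rule eval_Comp)
next
  case (PrimRec f g)
  then obtain n ys where xs: "xs = n # ys" by (cases xs) auto
  have "rec_nat (run (chi X) t f ys)
      (\<lambda>i u. if u = 0 then 0 else run (chi X) t g (i # (u - 1) # ys)) n = Suc v
    \<Longrightarrow> eval X (PrimRec f g) (n # ys) v"
  proof (induction n arbitrary: v)
    case 0
    then show ?case using PrimRec.IH(1) by (auto intro: eval_PrimRec_0)
  next
    case (Suc n)
    let ?u = "rec_nat (run (chi X) t f ys)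
      (\<lambda>i u. if u = 0 then 0 else run (chi X) t g (i # (u - 1) # ys)) n"
    from Suc.prems obtain u where u: "?u = Suc u" by (cases ?u) auto
    with Suc.prems have "run (chi X) t g (n # u # ys) = Suc v" by simp
    then show ?case using eval_PrimRec_Suc[OF Suc.IH[OF u]] PrimRec.IH(2) by blast
  qed
  then show ?case using PrimRec.prems xs by (simp cong: if_cong)
next
  case (Mu f)
  define st where "st s = rec_nat 0 (\<lambda>z u. if u \<noteq> 0 then u
       else if run (chi X) t f (z # xs) = 0 then 1
       else if run (chi X) t f (z # xs) = 1 then Suc (Suc z) else 0) s" for s
  have st_Suc: "st (Suc z) = (if st z \<noteq> 0 then st z
       else if run (chi X) t f (z # xs) = 0 then 1
       else if run (chi X) t f (z # xs) = 1 then Suc (Suc z) else 0)" for z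
    by (simp add: st_def)
  \<comment> \<open>Search invariant: while the search is running, every argument tested so far gave
    a positive value, as \<open>eval_Mu\<close> demands.\<close>
  have "(st s = 0 \<longrightarrow> (\<forall>z<s. \<exists>w. eval X f (z # xs) (Suc w))) \<and>
      (\<forall>y. st s = Suc (Suc y) \<longrightarrow> eval X (Mu f) xs y)" for s
  proof (induction s)
    case 0
    show ?case by (simp add: st_def)
  next
    case (Suc s)
    show ?case
    proof (cases "st s = 0")
      case False
      then show ?thesis using Suc by (simp add: st_Suc)
    next
      case True
      then have all: "\<forall>z<s. \<exists>w. eval X f (z # xs) (Suc w)" using Suc by blast
      consider "run (chi X) t f (s # xs) = 0" | "run (chi X) t f (s # xs) = Suc 0"
        | w where "run (chi X) t f (s # xs) = Suc (Suc w)"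
        by (metis not0_implies_Suc)
      then show ?thesis
      proof cases
        case 1
        then show ?thesis using True by (simp add: st_Suc)
      next
        case 2
        then show ?thesis using True eval_Mu[OF Mu.IH[OF 2] all] by (simp add: st_Suc)
      next
        case 3
        then show ?thesis using True all Mu.IH[OF 3] by (auto simp: st_Suc less_Suc_eq)
      qed
    qed
  qed
  moreover have "st t = Suc (Suc v)"
    using Mu.prems by (simp add: st_def)
  ultimately show ?case by blast
qed

text \<open>Stated for all large \<open>t\<close> rather than for some \<open>t\<close>, so that the
  finitely many subcomputations of a halting computation share one cut-off.\<close>

lemma run_complete: "eval X f xs v \<Longrightarrow> \<forall>\<^sub>F t in sequentially. run (chi X) t f xs = Suc v"
proof (induction rule: eval.induct)
  case (eval_Comp xs gs ys f v)
  have "\<forall>\<^sub>F t in sequentially. \<forall>i\<in>{..<length gs}. run (chi X) t (gs ! i) xs = Suc (ys ! i)"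
    using list_all2_nthD[OF eval_Comp.IH(1)] by (intro eventually_ball_finite) auto
  with eval_Comp.IH(2) show ?case
  proof eventually_elim
    case (elim t)
    have "map (\<lambda>g. run (chi X) t g xs) gs = map Suc ys"
      using elim list_all2_lengthD[OF eval_Comp.IH(1)] by (auto intro: nth_equalityI)
    then have "map (\<lambda>y. y - 1) (map (\<lambda>g. run (chi X) t g xs) gs) = ys"
      "0 \<notin> set (map (\<lambda>g. run (chi X) t g xs) gs)"
      by (simp_all add: comp_def image_iff)
    then show ?case using elim by (simp del: map_map set_map)
  qed
next
  case (eval_PrimRec_Suc f g n xs u v)
  from eval_PrimRec_Suc.IH show ?case
    by eventually_elim (simp cong: if_cong)
next
  case (eval_Mu f y xs)
  have "\<forall>\<^sub>F t in sequentially. \<forall>z\<in>{..<y}. \<exists>w. run (chi X) t f (z # xs) = Suc (Suc w)"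
  proof (intro eventually_ball_finite ballI)
    fix z assume "z \<in> {..<y}"
    then obtain w where "\<forall>\<^sub>F t in sequentially. run (chi X) t f (z # xs) = Suc (Suc w)"
      using eval_Mu.IH(2) by auto
    then show "\<forall>\<^sub>F t in sequentially. \<exists>w. run (chi X) t f (z # xs) = Suc (Suc w)"
      by (rule eventually_mono) blast
  qed simp
  with eval_Mu.IH(1) eventually_gt_at_top[of y] show ?case
  proof eventually_elim
    case (elim t)
    define st where "st s = rec_nat 0 (\<lambda>z u. if u \<noteq> 0 then u
         else if run (chi X) t f (z # xs) = 0 then 1
         else if run (chi X) t f (z # xs) = 1 then Suc (Suc z) else 0) s" for s
    have st_Suc: "st (Suc z) = (if st z \<noteq> 0 then st z
         else if run (chi X) t f (z # xs) = 0 then 1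
         else if run (chi X) t f (z # xs) = 1 then Suc (Suc z) else 0)" for z
      by (simp add: st_def)
    have "st s = 0" if "s \<le> y" for s
      using that
    proof (induction s)
      case 0
      show ?case by (simp add: st_def)
    next
      case (Suc s)
      then obtain w where "run (chi X) t f (s # xs) = Suc (Suc w)"
        using elim by (meson Suc_le_lessD lessThan_iff)
      then show ?case using Suc by (simp add: st_Suc)
    qed
    then have found: "st (Suc y) = Suc (Suc y)"
      using elim by (simp add: st_Suc)
    \<comment> \<open>A finished search keeps its state, so the result survives up to the cut-off
      \<open>t > y\<close>.\<close>
    have "st s = Suc (Suc y)" if "Suc y \<le> s" for s
      using that
    proof (induction rule: dec_induct)
      case (step s)
      then show ?case by (simp add: st_Suc[of s])
    qed (rule found)
    then have "st t = Suc (Suc y)"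
      using elim by (simp add: Suc_le_eq)
    then show ?case by (simp add: st_def)
  qed
qed simp_all

lemma eval_iff_run: "eval X f xs v \<longleftrightarrow> (\<exists>t. run (chi X) t f xs = Suc v)"
  using run_sound eventually_happens'[OF sequentially_bot run_complete] by blast

lemma eval_use:
  "eval X f xs v \<Longrightarrow> \<forall>\<^sub>F u in sequentially. \<forall>Y. (\<forall>z<u. z \<in> Y \<longleftrightarrow> z \<in> X) \<longrightarrow> eval Y f xs v"
proof (induction rule: eval.induct)
  case (eval_Query x xs)
  show ?case
    using eventually_gt_at_top[of x]
  proof eventually_elim
    case (elim u)
    then have "chi X x = chi Y x" if "\<forall>z<u. z \<in> Y \<longleftrightarrow> z \<in> X" for Y
      using that by (simp add: chi_def)
    then show ?case by (simp add: eval.eval_Query)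
  qed
next
  case (eval_Comp xs gs ys f v)
  have "\<forall>\<^sub>F u in sequentially. \<forall>i\<in>{..<length gs}.
      \<forall>Y. (\<forall>z<u. z \<in> Y \<longleftrightarrow> z \<in> X) \<longrightarrow> eval Y (gs ! i) xs (ys ! i)"
    using list_all2_nthD[OF eval_Comp.IH(1)] by (intro eventually_ball_finite) auto
  with eval_Comp.IH(2) show ?case
  proof eventually_elim
    case (elim u)
    then show ?case
      using list_all2_lengthD[OF eval_Comp.IH(1)]
      by (intro allI impI eval.eval_Comp[of _ _ gs ys]) (auto simp: list_all2_conv_all_nth)
  qed
next
  case (eval_PrimRec_Suc f g n xs u v)
  from eval_PrimRec_Suc.IH show ?case
    by eventually_elim (meson eval.eval_PrimRec_Suc)
next
  case (eval_Mu f y xs)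
  have "\<forall>\<^sub>F u in sequentially. \<forall>s\<in>{..<y}. \<exists>w.
      \<forall>Y. (\<forall>z<u. z \<in> Y \<longleftrightarrow> z \<in> X) \<longrightarrow> eval Y f (s # xs) (Suc w)"
  proof (intro eventually_ball_finite ballI)
    fix s assume "s \<in> {..<y}"
    then obtain w where "\<forall>\<^sub>F u in sequentially.
        \<forall>Y. (\<forall>z<u. z \<in> Y \<longleftrightarrow> z \<in> X) \<longrightarrow> eval Y f (s # xs) (Suc w)"
      using eval_Mu.IH(2) by auto
    then show "\<forall>\<^sub>F u in sequentially.
        \<exists>w. \<forall>Y. (\<forall>z<u. z \<in> Y \<longleftrightarrow> z \<in> X) \<longrightarrow> eval Y f (s # xs) (Suc w)"
      by (rule eventually_mono) blast
  qed simp
  with eval_Mu.IH(1) show ?case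
  proof eventually_elim
    case (elim u)
    then show ?case by (intro allI impI eval.eval_Mu) blast+
  qed
qed (auto simp: eval.eval_Zero eval.eval_Succ eval.eval_Proj intro: eval.eval_PrimRec_0
    elim!: eventually_mono)

text \<open>The argument list holds \<open>k\<close> inputs, then the cut-off, then \<open>q\<close>
  parameters that determine the oracle. The induction lets \<open>k\<close> vary because subprograms
  take different numbers of inputs.\<close>

lemma recursive_run:
  assumes h: "recursive (Suc q) (\<lambda>zs. h (drop 1 zs) (zs ! 0))"
  shows "recursive (k + Suc q) (\<lambda>zs. run (h (drop (Suc k) zs)) (zs ! k) f (take k zs))"
proof (induction f arbitrary: k)
  case Zero
  show ?case by (simp add: recursive_const)
next
  case Succ
  show ?case
  proof (cases k)
    case (Suc j)
    show ?thesis
      by (rule recursive_cong[of _ "\<lambda>zs. Suc (Suc (zs ! 0))"])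
        (use Suc in \<open>auto intro!: recursive_intros\<close>)
  qed (simp add: recursive_const)
next
  case (Proj i)
  show ?case
  proof (cases "i < k")
    case True
    show ?thesis
      by (rule recursive_cong[of _ "\<lambda>zs. Suc (zs ! i)"])
        (use True in \<open>auto intro!: recursive_intros\<close>)
  next
    case False
    show ?thesis
      by (rule recursive_cong[OF recursive_const[of _ 0]]) (use False in auto)
  qed
next
  case Query
  show ?case
  proof (cases k)
    case (Suc j)
    have "recursive (k + Suc q) (\<lambda>zs. (zs ! 0 # drop (Suc k) zs) ! i)" if "i < Suc q" for i
      using that by (cases i) (auto intro!: recursive_intros)
    from recursive_Suc[OF recursive_subst[OF h this]] show ?thesis
      by (rule recursive_cong) (use Suc in auto)
  qed (simp add: recursive_const)
next
  case (Comp f gs)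
  let ?r = "\<lambda>g zs. run (h (drop (Suc k) zs)) (zs ! k) g (take k zs)"
  \<comment> \<open>The results of \<open>gs\<close> replace the inputs, while
    \<open>drop k zs\<close> carries over the cut-off and the oracle parameters.\<close>
  let ?H = "\<lambda>zs. map (\<lambda>g. ?r g zs - 1) gs @ drop k zs"
  have "recursive (k + Suc q) (\<lambda>zs. ?H zs ! i)" if "i < length gs + Suc q" for i
  proof (cases "i < length gs")
    case True
    show ?thesis
      by (rule recursive_cong[OF recursive_pred[OF Comp.IH(2)[of "gs ! i"]]])
        (use True in \<open>auto simp: nth_append\<close>)
  next
    case False
    show ?thesis
      by (rule recursive_cong[OF recursive_proj[of "k + (i - length gs)"]])
        (use False that in \<open>auto simp: nth_append\<close>)
  qed
  from recursive_subst[OF Comp.IH(1) this]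
  have f: "recursive (k + Suc q)
      (\<lambda>zs. run (h (drop (Suc k) zs)) (zs ! k) f (map (\<lambda>g. ?r g zs - 1) gs))"
    by (rule recursive_cong) (auto simp: nth_append)
  have "decidable (k + Suc q) (\<lambda>zs. 0 \<in> set (map (\<lambda>g. ?r g zs) gs'))" if "set gs' \<subseteq> set gs" for gs'
    using that
  proof (induction gs')
    case Nil
    show ?case by (simp add: decidable_const)
  next
    case (Cons g gs')
    have "decidable (k + Suc q) (\<lambda>zs. ?r g zs = 0 \<or> 0 \<in> set (map (\<lambda>g. ?r g zs) gs'))"
      using Cons by (intro decidable_disj decidable_eq0 Comp.IH(2)) auto
    then show ?case by (simp add: eq_commute[of 0])
  qed
  then have "recursive (k + Suc q) (\<lambda>zs. if 0 \<in> set (map (\<lambda>g. ?r g zs) gs) then 0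
      else run (h (drop (Suc k) zs)) (zs ! k) f (map (\<lambda>g. ?r g zs - 1) gs))"
    by (intro recursive_if f recursive_const) auto
  then show ?case by (simp add: comp_def cong: if_cong)
next
  case (PrimRec f g)
  show ?case
  proof (cases k)
    case 0
    then show ?thesis by (simp add: recursive_const)
  next
    case (Suc j)
    let ?K = "k + Suc q"
    let ?t = "\<lambda>zs :: nat list. zs ! k" and ?h = "\<lambda>zs. h (drop (Suc k) zs)"
    have f: "recursive ?K (\<lambda>zs. run (?h zs) (?t zs) f (take j (drop 1 zs)))"
    proof (rule recursive_cong[OF recursive_subst[OF PrimRec.IH(1)[of j], of _ "drop 1"]])
      show "recursive ?K (\<lambda>zs. drop 1 zs ! i)" if "i < j + Suc q" for i
        using that Suc by (auto intro: recursive_intros)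
    qed (use Suc in auto)
    have "recursive (Suc (Suc ?K)) (\<lambda>ys. (ys ! 0 # (ys ! 1 - 1) # drop 3 ys) ! i)"
      if "i < Suc (Suc j) + Suc q" for i
    proof (cases "i < 2")
      case True
      then show ?thesis by (cases i) (auto intro!: recursive_intros)
    next
      case False
      then obtain l where "i = Suc (Suc l)"
        by (metis One_nat_def Suc_1 less_2_cases_iff not0_implies_Suc)
      then show ?thesis using that Suc by (auto intro!: recursive_intros)
    qed
    from recursive_subst[OF PrimRec.IH(2) this]
    have g: "recursive (Suc (Suc ?K)) (\<lambda>ys. run (?h (drop 2 ys)) (?t (drop 2 ys)) g
        (ys ! 0 # (ys ! 1 - 1) # take j (drop 1 (drop 2 ys))))"
      by (rule recursive_cong) (use Suc in \<open>auto simp: numeral_eq_Suc\<close>)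
    have "recursive ?K (\<lambda>zs. rec_nat (run (?h zs) (?t zs) f (take j (drop 1 zs)))
        (\<lambda>i u. if u = 0 then 0
          else run (?h zs) (?t zs) g (i # (u - 1) # take j (drop 1 zs))) (zs ! 0))"
      by (intro recursive_rec_nat recursive_if decidable_eq f g recursive_intros) auto
    then show ?thesis
      by (rule recursive_cong) (use Suc in \<open>auto simp: tl_take drop_Suc cong: if_cong\<close>)
  qed
next
  case (Mu f)
  let ?K = "k + Suc q"
  let ?r = "\<lambda>zs z. run (h (drop (Suc k) zs)) (zs ! k) f (z # take k zs)"
  have "recursive (Suc (Suc ?K)) (\<lambda>ys. (ys ! 0 # drop 2 ys) ! i)" if "i < Suc k + Suc q" for i
    using that by (cases i) (auto intro!: recursive_intros)
  from recursive_subst[OF Mu.IH this]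
  have r: "recursive (Suc (Suc ?K)) (\<lambda>ys. ?r (drop 2 ys) (ys ! 0))"
    by (rule recursive_cong) auto
  have "recursive ?K (\<lambda>zs. rec_nat 0 (\<lambda>z u. if u \<noteq> 0 then u
       else if ?r zs z = 0 then 1 else if ?r zs z = 1 then Suc (Suc z) else 0) (zs ! k) - 1)"
    by (intro recursive_pred recursive_rec_nat recursive_intros r) auto
  then show ?case by simp
qed

lemma recursive_run_unary:
  assumes "recursive (Suc q) (\<lambda>zs. h (drop 1 zs) (zs ! 0))"
    and "recursive k a" "recursive k t"
    and "\<And>i. i < q \<Longrightarrow> recursive k (\<lambda>zs. e zs ! i)" "\<And>zs. length zs = k \<Longrightarrow> length (e zs) = q"
  shows "recursive k (\<lambda>zs. run (h (e zs)) (t zs) f [a zs])"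
proof -
  have "recursive k (\<lambda>zs. (a zs # t zs # e zs) ! i)" if "i < 1 + Suc q" for i
    using that assms(2-4) by (cases i rule: nat.exhaust; cases "i - 1") auto
  from recursive_subst[OF recursive_run[OF assms(1), of 1 f] this] assms(5)
  show ?thesis by simp
qed

section \<open>Strings and searches\<close>

lemma Sigma01_strings_decidable:
  assumes "decidable 2 (\<lambda>xs. R (xs ! 0) (xs ! 1))"
  shows "Sigma01_strings {\<sigma>. \<exists>y. R (string_code \<sigma>) y}"
proof -
  obtain p where "\<And>xs. length xs = 2 \<Longrightarrow> eval {} p xs (of_bool (R (xs ! 0) (xs ! 1)))"
    using assms unfolding decidable_def recursive_def by blast
  then have "eval {} p [x, y] (of_bool (R x y))" for x y
    by (metis One_nat_def Suc_1 length_Cons list.size(3) nth_Cons_0 nth_Cons_Suc)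
  then show ?thesis
    unfolding Sigma01_strings_def computable_rel_def by blast
qed

text \<open>\<open>F n y = 0\<close> marks \<open>y\<close> as no witness, and any other value is
  one more than the answer; the least witness therefore gives the right value.\<close>

lemma computable_by_search:
  assumes F: "recursive 2 (\<lambda>xs. F (xs ! 0) (xs ! 1))"
    and ex: "\<And>n. \<exists>y. F n y \<noteq> 0"
    and val: "\<And>n y. F n y \<noteq> 0 \<Longrightarrow> F n y = Suc (chi B n)"
  shows "computable B"
proof -
  \<comment> \<open>The arguments are swapped because \<open>Mu\<close> puts the search variable
    first.\<close>
  have "recursive 2 (\<lambda>xs. F (xs ! 1) (xs ! 0))"
    using recursive_comp2[OF F, of 2 "\<lambda>xs. xs ! 1" "\<lambda>xs. xs ! 0"] by (simp add: recursive_proj)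
  from decidable_eq0[OF this] obtain q where
    q: "\<And>xs. length xs = 2 \<Longrightarrow> eval {} q xs (of_bool (F (xs ! 1) (xs ! 0) = 0))"
    unfolding decidable_def recursive_def by blast
  obtain p where p: "\<And>xs. length xs = 2 \<Longrightarrow> eval {} p xs (F (xs ! 0) (xs ! 1) - 1)"
    using recursive_pred[OF F] unfolding recursive_def by blast
  have "eval {} (Comp p [Proj 0, Mu q]) [n] (chi B n)" for n
  proof (rule eval_Comp)
    define y where "y = (LEAST y. F n y \<noteq> 0)"
    have y: "F n y \<noteq> 0" unfolding y_def using ex by (rule LeastI_ex)
    have less: "F n z = 0" if "z < y" for z
      using that not_less_Least unfolding y_def by blast
    have "eval {} (Mu q) [n] y"
    proof (rule eval_Mu)
      show "eval {} q [y, n] 0"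
        using q[of "[y, n]"] y by simp
      show "\<forall>z<y. \<exists>w. eval {} q [z, n] (Suc w)"
        using q[of "[_, n]"] less by (metis (mono_tags, lifting) One_nat_def Suc_1 length_Cons
            list.size(3) nth_Cons_0 nth_Cons_Suc of_bool_eq(2))
    qed
    then show "list_all2 (\<lambda>g y. eval {} g [n] y) [Proj 0, Mu q] [n, y]"
      using eval_Proj[of 0 "[n]"] by simp
    show "eval {} p [n, y] (chi B n)"
      using p[of "[n, y]"] val[OF y] by simp
  qed
  then show ?thesis
    unfolding computable_def functional_eq_Some_iff by blast
qed

lemma ex_prod_decode:
  "(\<exists>y. Q (fst (prod_decode y)) (snd (prod_decode y))) \<longleftrightarrow> (\<exists>a b. Q a b)"
  by (metis fst_conv prod_encode_inverse snd_conv)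

definition string_map :: "bool list \<Rightarrow> nat \<Rightarrow> bool option" where
  "string_map \<sigma> x = (if x < length \<sigma> then Some (\<sigma> ! x) else None)"

text \<open>Every number is a code: an entry other than 1 counts as \<open>False\<close>.\<close>

definition decode_bits :: "nat \<Rightarrow> nat \<Rightarrow> bool option" where
  "decode_bits c x = (if lookup c x = 0 then None else Some (lookup c x = 2))"

text \<open>Entry 0 stands for an unrevealed position and entry \<open>Suc l\<close> for the delay
  \<open>l\<close>; with the shift in \<open>lookup\<close> this makes the offset 2.\<close>

definition decode_delays :: "nat \<Rightarrow> nat \<Rightarrow> nat option" where
  "decode_delays c x = (if lookup c x \<le> 1 then None else Some (lookup c x - 2))"

lemma lookup_string_code:
  "lookup (string_code \<sigma>) x = (if x < length \<sigma> then Suc (of_bool (\<sigma> ! x)) else 0)"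
  by (simp add: string_code_def lookup_list_encode)

lemma decode_bits_string_code [simp]: "decode_bits (string_code \<sigma>) = string_map \<sigma>"
  by (auto simp: decode_bits_def string_map_def lookup_string_code fun_eq_iff)

lemma decode_delays_surj:
  assumes "dom d \<subseteq> {..<u}"
  shows "\<exists>c. decode_delays c = d"
proof
  let ?ys = "map (\<lambda>x. case d x of None \<Rightarrow> 0 | Some l \<Rightarrow> Suc l) [0..<u]"
  show "decode_delays (list_encode ?ys) = d"
  proof
    fix x
    show "decode_delays (list_encode ?ys) x = d x"
      using assms by (cases "d x") (auto simp: decode_delays_def lookup_list_encode)
  qed
qed

lemma string_map_initial_segment:
  "string_map (initial_segment A k) x = (if x < k then Some (x \<in> A) else None)"
  by (simp add: string_map_def initial_segment_def)

lemma prefix_initial_segmentI: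
  assumes "k \<le> length \<sigma>" "\<And>x. x < k \<Longrightarrow> \<sigma> ! x = (x \<in> A)"
  shows "prefix (initial_segment A k) \<sigma>"
proof -
  have "initial_segment A k = take k \<sigma>"
    using assms by (auto simp: initial_segment_def intro: nth_equalityI)
  then show ?thesis by (simp add: take_is_prefix)
qed

section \<open>Density and dyadic blocks\<close>

text \<open>If block \<open>k\<close> were missed, at most half of the numbers below
  \<open>2 ^ (k + 1)\<close> could lie in \<open>X\<close>.\<close>

lemma density_1_meets_dyadic:
  assumes "density_1 X"
  shows "\<exists>N. \<forall>k\<ge>N. \<exists>x\<in>X. 2 ^ k \<le> x \<and> x < 2 ^ (k + 1)"
proof -
  have "\<forall>\<^sub>F n in sequentially. 1 / 2 < real (card (X \<inter> {..<n})) / real n"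
    using assms unfolding density_1_def by (rule order_tendstoD) simp
  then obtain N where N: "\<And>n. N \<le> n \<Longrightarrow> 1 / 2 < real (card (X \<inter> {..<n})) / real n"
    unfolding eventually_sequentially by blast
  have "\<exists>x\<in>X. 2 ^ k \<le> x \<and> x < 2 ^ (k + 1)" if "N \<le> k" for k
  proof (rule ccontr)
    assume "\<not> ?thesis"
    then have "X \<inter> {..<2 ^ (k + 1)} \<subseteq> {..<2 ^ k}" by force
    then have "card (X \<inter> {..<2 ^ (k + 1)}) \<le> 2 ^ k"
      using card_mono[of "{..<2 ^ k :: nat}"] by simp
    then have "real (card (X \<inter> {..<2 ^ (k + 1)})) \<le> 2 ^ k"
      by (metis of_nat_le_iff of_nat_numeral of_nat_power)
    moreover have "N \<le> 2 ^ (k + 1)"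
      using that less_exp[of "k + 1"] by linarith
    ultimately show False
      using N[of "2 ^ (k + 1)"] by (simp add: field_simps)
  qed
  then show ?thesis by blast
qed

text \<open>For each \<open>e\<close> the complement has upper density at most
  \<open>2 ^ -e\<close>, since the constant \<open>c\<close> vanishes after division by
  \<open>n\<close>.\<close>

lemma density_1I:
  assumes "\<And>e. \<exists>c. \<forall>n. card ({..<n} - X) \<le> c + n div 2 ^ e"
  shows "density_1 X"
  unfolding density_1_def
proof (rule tendstoI)
  fix \<epsilon> :: real assume "0 < \<epsilon>"
  then obtain e where e: "(1 / 2) ^ e < \<epsilon> / 2"
    using real_arch_pow_inv[of "\<epsilon> / 2" "1 / 2"] by auto
  obtain c where c: "\<And>n. card ({..<n} - X) \<le> c + n div 2 ^ e"
    using assms by blast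
  have "(\<lambda>n. real c / real n) \<longlonglongrightarrow> 0"
    by (rule lim_const_over_n)
  then have "\<forall>\<^sub>F n in sequentially. real c / real n < \<epsilon> / 2"
    using \<open>0 < \<epsilon>\<close> by (intro order_tendstoD) auto
  with eventually_gt_at_top[of 0]
  show "\<forall>\<^sub>F n in sequentially. dist (real (card (X \<inter> {..<n})) / real n) 1 < \<epsilon>"
  proof eventually_elim
    case (elim n)
    have "card (X \<inter> {..<n}) + card ({..<n} - X) = n"
      using card_Int_Diff[of "{..<n}" X] by (simp add: Int_commute)
    then have n: "real (card (X \<inter> {..<n})) = real n - real (card ({..<n} - X))"
      by linarith
    have "real (n div 2 ^ e) \<le> real n / 2 ^ e"
      using of_nat_div_le_of_nat[of n "2 ^ e", where 'a = real] by simp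
    then have "real (card ({..<n} - X)) \<le> real c + real n / 2 ^ e"
      using c[of n] by linarith
    then have "real (card ({..<n} - X)) / real n \<le> real c / real n + (1 / 2) ^ e"
      using elim by (simp add: field_simps power_one_over)
    then have "real (card ({..<n} - X)) / real n < \<epsilon>"
      using elim e by linarith
    moreover have "real (card (X \<inter> {..<n})) / real n - 1 = - (real (card ({..<n} - X)) / real n)"
      using elim by (simp add: n field_simps)
    ultimately show ?case
      by (simp add: dist_real_def)
  qed
qed

text \<open>Beyond \<open>m e\<close> at most one element is missing from each aligned window of length \<open>2 ^ e\<close>,
  because the stage boundaries are aligned as well.\<close>

lemma density_1_stages:
  fixes m :: "nat \<Rightarrow> nat"
  assumes mono: "strict_mono m" and dvd: "\<And>e. 2 ^ e dvd m e"
    and hidden: "\<And>e x y. m e \<le> x \<Longrightarrow> x < m (Suc e) \<Longrightarrow> x \<notin> X \<Longrightarrow>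
      m e \<le> y \<Longrightarrow> y < m (Suc e) \<Longrightarrow> y \<notin> X \<Longrightarrow> x mod 2 ^ e = y mod 2 ^ e"
  shows "density_1 X"
proof (rule density_1I)
  fix e :: nat
  have window: "x = y" if x: "m e \<le> x" "x \<notin> X" and y: "m e \<le> y" "y \<notin> X"
    and eq: "x div 2 ^ e = y div 2 ^ e" for x y
  proof -
    \<comment> \<open>The first boundary above \<open>x\<close> closes the stage to which
      \<open>x\<close> belongs.\<close>
    define i where "i = (LEAST i. x < m i)"
    have "x < m (Suc x)"
      using strict_mono_imp_increasing[OF mono, of "Suc x"] by simp
    then have i: "x < m i" unfolding i_def by (rule LeastI)
    have "e < i"
    proof (rule ccontr)
      assume "\<not> e < i"
      then have "m i \<le> m e" using mono by (simp add: strict_mono_less_eq)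
      with i x(1) show False by simp
    qed
    then obtain e' where e': "i = Suc e'" "e \<le> e'"
      by (cases i) auto
    have "m e' \<le> x"
      using not_less_Least[of e' "\<lambda>i. x < m i"] e' unfolding i_def by simp
    \<comment> \<open>A boundary divisible by \<open>2 ^ e\<close> cannot separate two members of
      one window, so \<open>y\<close> belongs to the same stage as \<open>x\<close>.\<close>
    have bound: "y < m a \<longleftrightarrow> x < m a" if "e \<le> a" for a
    proof -
      have "(2::nat) ^ e dvd m a"
        using dvd[of a] le_imp_power_dvd[OF that, of "2::nat"] dvd_trans by blast
      then obtain c where c: "m a = c * 2 ^ e" by (metis dvd_div_mult_self)
      show ?thesis
        unfolding c using eq by (metis div_less_iff_less_mult zero_less_numeral zero_less_power)
    qed
    have "x mod 2 ^ e' = y mod 2 ^ e'"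
      using hidden[of e' x y] i \<open>m e' \<le> x\<close> x y e' bound[of e'] bound[of i] by (simp add: not_less[symmetric])
    then have "x mod 2 ^ e = y mod 2 ^ e"
      by (metis e'(2) le_imp_power_dvd mod_mod_cancel)
    with eq show "x = y"
      by (metis div_mult_mod_eq)
  qed
  have "card ({..<n} - X) \<le> m e + 1 + n div 2 ^ e" for n
  proof -
    have "inj_on (\<lambda>x. x div 2 ^ e) ({m e..<n} - X)"
      using window by (auto intro!: inj_onI)
    then have "card ({m e..<n} - X) \<le> card {..n div 2 ^ e}"
      by (rule card_inj_on_le) (auto intro: div_le_mono)
    moreover have "card ({..<n} - X) \<le> card ({..<m e} \<union> ({m e..<n} - X))"
      by (rule card_mono) auto
    moreover have "card ({..<m e} \<union> ({m e..<n} - X)) \<le> card {..<m e} + card ({m e..<n} - X)"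
      by (rule card_Un_le)
    ultimately show ?thesis by simp
  qed
  then show "\<exists>c. \<forall>n. card ({..<n} - X) \<le> c + n div 2 ^ e" by blast
qed

text \<open>Dyadic blocks are disjoint, so membership depends only on \<open>k\<close>, and the
  exponent of 2 in \<open>k\<close> is \<open>n\<close>. Each \<open>n\<close> is thus coded in
  infinitely many whole blocks.\<close>

lemma RR_tilde_RR_iff:
  assumes k: "k = (2 * i + 1) * 2 ^ n" and r: "r < 2 ^ k"
  shows "2 ^ k + r \<in> RR_tilde (RR B) \<longleftrightarrow> n \<in> B"
proof -
  have "l = k" if l: "2 ^ l \<le> 2 ^ k + r" "2 ^ k + r < 2 ^ (l + 1)" for l
  proof -
    have "(2::nat) ^ l < 2 ^ (k + 1)" "(2::nat) ^ k < 2 ^ (l + 1)"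
      using l r by auto
    then show ?thesis
      using power_less_imp_less_exp[of "2::nat" l "k + 1"]
        power_less_imp_less_exp[of "2::nat" k "l + 1"] by linarith
  qed
  then have "2 ^ k + r \<in> RR_tilde (RR B) \<longleftrightarrow> k \<in> RR B"
    unfolding RR_tilde_def using r by (auto intro!: bexI[of _ k])
  also have "\<dots> \<longleftrightarrow> n \<in> B"
  proof
    \<comment> \<open>Only one inequality is proved; exchanging the two representations gives the
      other.\<close>
    have odd_part: "n' \<le> n" if "(2 * i + 1) * 2 ^ n = (2 * i' + 1) * 2 ^ n'" for i n i' n' :: nat
    proof -
      have "2 ^ n' dvd 2 ^ n * (2 * i + 1)"
        using that by (metis dvd_triv_right mult.commute)
      moreover have "coprime (2 ^ n') (2 * i + 1)"
        by (simp add: coprime_left_2_iff_odd)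
      ultimately have "(2::nat) ^ n' dvd 2 ^ n"
        using coprime_dvd_mult_left_iff by blast
      then show ?thesis
        by (simp add: power_dvd_imp_le)
    qed
    assume "k \<in> RR B"
    then obtain i' n' where "k = (2 * i' + 1) * 2 ^ n'" "n' \<in> B"
      unfolding RR_def by blast
    moreover from this have "n' = n"
      using odd_part[of i n i' n'] odd_part[of i' n' i n] k by simp
    ultimately show "n \<in> B" by simp
  qed (auto simp: RR_def k)
  finally show ?thesis .
qed

section \<open>1-generic reals are not generically computable\<close>

text \<open>The strings contradicting \<open>f\<close> form a \<open>\<Sigma>\<close>01 set that
  \<open>A\<close> never meets. Every initial segment nevertheless extends into it: density supplies
  a later argument on which \<open>f\<close> halts, and the bit there can be chosen wrongly.\<close>

lemma one_generic_not_generically_computable: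
  assumes "one_generic A"
  shows "\<not> generically_computable A"
proof
  assume "generically_computable A"
  then obtain f where dens: "density_1 (dom (functional f {}))"
    and val: "\<And>n v. eval {} f [n] v \<Longrightarrow> v = chi A n"
    unfolding generically_computable_def generic_computation_def functional_eq_Some_iff by blast
  define r where "r n t = run (chi {}) t f [n]" for n t
  \<comment> \<open>Both \<open>r\<close> and \<open>lookup\<close> shift their values by one and
    use 0 for undefined, so they can be compared directly.\<close>
  define R where "R s y \<longleftrightarrow> (let n = fst (prod_decode y); t = snd (prod_decode y) in
    lookup s n \<noteq> 0 \<and> r n t \<noteq> 0 \<and> r n t \<noteq> lookup s n)" for s y
  define S where "S = {\<sigma>. \<exists>y. R (string_code \<sigma>) y}"
  have r: "recursive k (\<lambda>zs. r (a zs) (t zs))" if "recursive k a" "recursive k t" for k a t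
    unfolding r_def
    by (rule recursive_run_unary[where q = 0 and e = "\<lambda>_. []" and h = "\<lambda>_. chi {}"])
      (use that in \<open>simp_all add: chi_def recursive_const\<close>)
  have "decidable 2 (\<lambda>xs. R (xs ! 0) (xs ! 1))"
    unfolding R_def Let_def by (intro recursive_pair_intros recursive_lookup r) auto
  then have "Sigma01_strings S"
    unfolding S_def by (rule Sigma01_strings_decidable)
  have S_iff: "\<sigma> \<in> S \<longleftrightarrow> (\<exists>n<length \<sigma>. \<exists>v. eval {} f [n] v \<and> v \<noteq> of_bool (\<sigma> ! n))" for \<sigma>
  proof -
    have "\<sigma> \<in> S \<longleftrightarrow> (\<exists>n t. lookup (string_code \<sigma>) n \<noteq> 0 \<and> r n t \<noteq> 0 \<and>
        r n t \<noteq> lookup (string_code \<sigma>) n)"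
      unfolding S_def R_def Let_def mem_Collect_eq by (rule ex_prod_decode)
    also have "\<dots> \<longleftrightarrow> (\<exists>n t. n < length \<sigma> \<and> r n t \<noteq> 0 \<and> r n t \<noteq> Suc (of_bool (\<sigma> ! n)))"
      by (intro ex_cong1) (auto simp: lookup_string_code)
    also have "\<dots> \<longleftrightarrow> (\<exists>n<length \<sigma>. \<exists>v. eval {} f [n] v \<and> v \<noteq> of_bool (\<sigma> ! n))"
      unfolding eval_iff_run r_def by (metis not0_implies_Suc nat.distinct(1) nat.inject)
    finally show ?thesis .
  qed
  have "initial_segment A k \<notin> S" for k
    using val unfolding S_iff by (auto simp: initial_segment_def chi_def)
  then obtain k where k: "\<And>\<tau>. prefix (initial_segment A k) \<tau> \<Longrightarrow> \<tau> \<notin> S"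
    using assms \<open>Sigma01_strings S\<close> unfolding one_generic_def by blast
  obtain N where N: "\<forall>k\<ge>N. \<exists>x\<in>dom (functional f {}). 2 ^ k \<le> x \<and> x < 2 ^ (k + 1)"
    using density_1_meets_dyadic[OF dens] by blast
  obtain n where n: "n \<in> dom (functional f {})" "2 ^ max N k \<le> n"
    using N max.cobounded1 by blast
  then obtain v where v: "eval {} f [n] v"
    by (auto simp: functional_eq_Some_iff)
  have "k < n"
    using n(2) less_exp[of "max N k"] by linarith
  \<comment> \<open>The last bit, \<open>v = 0\<close>, differs from the answer
    \<open>v\<close>.\<close>
  define \<tau> where "\<tau> = map (\<lambda>x. if x < n then x \<in> A else v = 0) [0..<Suc n]"
  have "prefix (initial_segment A k) \<tau>"
    using \<open>k < n\<close> by (intro prefix_initial_segmentI) (auto simp: \<tau>_def nth_append)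
  moreover have "\<tau> ! n = (v = 0)" "length \<tau> = Suc n"
    by (simp_all add: \<tau>_def nth_append)
  then have "\<tau> \<in> S"
    unfolding S_iff using v by (intro exI[of _ n]) auto
  ultimately show False using k by blast
qed

section \<open>Finite partial oracles\<close>

text \<open>The oracle extends \<open>P\<close> by triples for arguments \<open>x \<ge> m\<close>: \<open>\<alpha>\<close> gives their values and \<open>d\<close>
  the delays of the arguments that are revealed.\<close>

definition extend_oracle ::
    "nat set \<Rightarrow> nat \<Rightarrow> (nat \<Rightarrow> bool option) \<Rightarrow> (nat \<Rightarrow> nat option) \<Rightarrow> nat set" where
  "extend_oracle P m \<alpha> d = P \<union> {prod_encode (x, prod_encode (of_bool b, l)) | x b l.
     m \<le> x \<and> \<alpha> x = Some b \<and> d x = Some l}"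

text \<open>The argument of \<open>f\<close> runs through the \<open>k\<close>-th dyadic block where \<open>k = (2 i + 1) 2 ^ n\<close>; on
  these blocks the characteristic function of \<open>RR_tilde (RR B)\<close> is \<open>chi B n\<close>.\<close>

definition decides ::
    "recfun \<Rightarrow> nat set \<Rightarrow> nat \<Rightarrow> (nat \<Rightarrow> bool option) \<Rightarrow> nat \<Rightarrow> nat \<Rightarrow> bool" where
  "decides f P m \<alpha> n v \<longleftrightarrow> (\<exists>d i r. r < 2 ^ ((2 * i + 1) * 2 ^ n) \<and>
     eval (extend_oracle P m \<alpha> d) f [2 ^ ((2 * i + 1) * 2 ^ n) + r] v)"

text \<open>Restricting the delays to the part of \<open>dom \<alpha>\<close> below \<open>u\<close>
  keeps hidden whatever \<open>\<beta>\<close> adds, so below \<open>u\<close> the oracle is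
  unchanged.\<close>

lemma extend_oracle_use:
  assumes "eval (extend_oracle P m \<alpha> d) f xs v"
  shows "\<forall>\<^sub>F u in sequentially. \<forall>\<beta>. (\<forall>x<u. \<forall>b. \<alpha> x = Some b \<longrightarrow> \<beta> x = Some b) \<longrightarrow>
    eval (extend_oracle P m \<beta> (d |` (dom \<alpha> \<inter> {..<u}))) f xs v"
  using eval_use[OF assms]
proof eventually_elim
  case (elim u)
  have *: "z \<in> extend_oracle P m \<beta> (d |` (dom \<alpha> \<inter> {..<u})) \<longleftrightarrow> z \<in> extend_oracle P m \<alpha> d"
    if \<beta>: "\<forall>x<u. \<forall>b. \<alpha> x = Some b \<longrightarrow> \<beta> x = Some b" and "z < u" for \<beta> z
  proof -
    obtain x c l where z: "z = prod_encode (x, prod_encode (c, l))"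
      by (metis prod_decode_inverse surj_pair)
    have "x < u"
      using le_prod_encode_1[of x "prod_encode (c, l)"] \<open>z < u\<close> z by linarith
    then show ?thesis
      using \<beta> unfolding z extend_oracle_def by (auto simp: restrict_map_def split: if_splits)
  qed
  show ?case by (intro allI impI elim[rule_format] *) auto
qed

lemma decides_use:
  assumes "decides f P m \<alpha> n v"
  shows "\<forall>\<^sub>F u in sequentially. \<forall>\<beta>. (\<forall>x<u. \<forall>b. \<alpha> x = Some b \<longrightarrow> \<beta> x = Some b) \<longrightarrow>
    decides f P m \<beta> n v"
proof -
  obtain d i r where "r < 2 ^ ((2 * i + 1) * 2 ^ n)"
    "eval (extend_oracle P m \<alpha> d) f [2 ^ ((2 * i + 1) * 2 ^ n) + r] v"
    using assms unfolding decides_def by blast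
  from extend_oracle_use[OF this(2)] this(1) show ?thesis
    unfolding decides_def by (auto elim!: eventually_mono)
qed

text \<open>Further values do no harm, because the delays chosen in \<open>decides\<close> may leave
  them unrevealed.\<close>

lemma decides_mono:
  assumes "decides f P m \<alpha> n v" "\<And>x b. \<alpha> x = Some b \<Longrightarrow> \<beta> x = Some b"
  shows "decides f P m \<beta> n v"
  using eventually_happens'[OF sequentially_bot decides_use[OF assms(1)]] assms(2) by blast

definition merge ::
    "(nat \<Rightarrow> bool) \<Rightarrow> (nat \<Rightarrow> bool option) \<Rightarrow> (nat \<Rightarrow> bool option) \<Rightarrow> nat \<Rightarrow> bool option" where
  "merge E \<alpha> \<beta> x = (if E x then \<beta> x else \<alpha> x)"

text \<open>Deciding is \<open>\<Sigma>\<close>01 uniformly in the coded strings: by the use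
  principle, delay maps with finite codes suffice. Recursiveness of \<open>w\<close> is stated as
  closure under substitution, ready for use in larger terms.\<close>

lemma decides_merge_Sigma01:
  assumes "finite P" and E: "\<And>k F. recursive k F \<Longrightarrow> decidable k (\<lambda>xs. E (F xs))"
  shows "\<exists>w. (\<forall>k F1 F2 F3 F4. recursive k F1 \<longrightarrow> recursive k F2 \<longrightarrow> recursive k F3 \<longrightarrow>
        recursive k F4 \<longrightarrow> recursive k (\<lambda>xs. w (F1 xs) (F2 xs) (F3 xs) (F4 xs))) \<and>
      (\<forall>s g n v. decides f P m (merge E (decode_bits s) (decode_bits g)) n v \<longleftrightarrow>
        (\<exists>h. w s g n h = Suc v))"
proof -
  \<comment> \<open>The parameter list \<open>e\<close> holds the codes of the base string, of the
    replacement string and of the delays.\<close>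
  define h where "h e = chi (extend_oracle P m
      (merge E (decode_bits (e ! 0)) (decode_bits (e ! 1))) (decode_delays (e ! 2)))" for e
  define q where "q e x = (if E x then lookup (e ! 1) x else lookup (e ! 0) x)" for e x
  define dec where "dec e x c l \<longleftrightarrow>
    m \<le> x \<and> q e x \<noteq> 0 \<and> (q e x = 2 \<and> c = 1 \<or> q e x \<noteq> 2 \<and> c = 0) \<and> lookup (e ! 2) x = Suc (Suc l)"
    for e and x c l :: nat
  have mem: "prod_encode (x, prod_encode (c, l)) \<in> extend_oracle P m
      (merge E (decode_bits (e ! 0)) (decode_bits (e ! 1))) (decode_delays (e ! 2)) \<longleftrightarrow>
    prod_encode (x, prod_encode (c, l)) \<in> P \<or> dec e x c l" for e x c l
    by (auto simp: extend_oracle_def dec_def q_def merge_def decode_bits_def decode_delays_def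
        split: if_splits)
  have h_eq: "h e z = of_bool (z \<in> P \<or> dec e (fst (prod_decode z))
      (fst (prod_decode (snd (prod_decode z)))) (snd (prod_decode (snd (prod_decode z)))))" for e z
  proof -
    obtain x c l where z: "z = prod_encode (x, prod_encode (c, l))"
      by (metis prod_decode_inverse surj_pair)
    show ?thesis unfolding z h_def chi_def mem by simp
  qed
  have "recursive 4 (\<lambda>zs. h (drop 1 zs) (zs ! 0))"
    unfolding h_eq dec_def q_def decidable_def[symmetric]
    by (intro recursive_pair_intros recursive_lookup E) (auto simp: assms)
  then have h: "recursive (Suc 3) (\<lambda>zs. h (drop 1 zs) (zs ! 0))" by simp
  define w' where "w' s g n c i r t = (if r < 2 ^ ((2 * i + 1) * 2 ^ n)
     then run (h [s, g, c]) t f [2 ^ ((2 * i + 1) * 2 ^ n) + r] else 0)" for s g n c i r t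
  \<comment> \<open>The witness \<open>y\<close> codes the delays, the block index \<open>i\<close>,
    the offset \<open>r\<close> and the cut-off \<open>t\<close>.\<close>
  define w where "w s g n y = w' s g n (fst (prod_decode y)) (fst (prod_decode (snd (prod_decode y))))
     (fst (prod_decode (snd (prod_decode (snd (prod_decode y))))))
     (snd (prod_decode (snd (prod_decode (snd (prod_decode y))))))" for s g n y
  have "recursive k (\<lambda>xs. w (F1 xs) (F2 xs) (F3 xs) (F4 xs))"
    if "recursive k F1" "recursive k F2" "recursive k F3" "recursive k F4" for k F1 F2 F3 F4
  proof -
    have e: "recursive k (\<lambda>xs. [F1 xs, F2 xs, fst (prod_decode (F4 xs))] ! i)" if "i < 3" for i
    proof -
      consider "i = 0" | "i = 1" | "i = 2" using \<open>i < 3\<close> by linarith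
      then show ?thesis
        using \<open>recursive k F1\<close> \<open>recursive k F2\<close> recursive_fst[OF \<open>recursive k F4\<close>] by cases auto
    qed
    show ?thesis
      unfolding w_def w'_def
      by (intro recursive_pair_intros recursive_run_unary[where h = h and q = 3] h e that) auto
  qed
  moreover have "decides f P m (merge E (decode_bits s) (decode_bits g)) n v \<longleftrightarrow>
      (\<exists>y. w s g n y = Suc v)" (is "decides f P m ?\<alpha> n v \<longleftrightarrow> _") for s g n v
  proof -
    have w': "(\<exists>t. w' s g n c i r t = Suc v) \<longleftrightarrow> r < 2 ^ ((2 * i + 1) * 2 ^ n) \<and>
      eval (extend_oracle P m ?\<alpha> (decode_delays c)) f [2 ^ ((2 * i + 1) * 2 ^ n) + r] v" for c i r
      unfolding eval_iff_run w'_def h_def by auto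
    have "(\<exists>y. w s g n y = Suc v) \<longleftrightarrow> (\<exists>c i r t. w' s g n c i r t = Suc v)"
    proof
      assume "\<exists>c i r t. w' s g n c i r t = Suc v"
      then obtain c i r t where "w' s g n c i r t = Suc v" by blast
      then have "w s g n (prod_encode (c, prod_encode (i, prod_encode (r, t)))) = Suc v"
        by (simp add: w_def)
      then show "\<exists>y. w s g n y = Suc v" ..
    qed (auto simp: w_def)
    also have "\<dots> \<longleftrightarrow> (\<exists>c i r. r < 2 ^ ((2 * i + 1) * 2 ^ n) \<and>
      eval (extend_oracle P m ?\<alpha> (decode_delays c)) f [2 ^ ((2 * i + 1) * 2 ^ n) + r] v)"
      unfolding w' ..
    also have "\<dots> \<longleftrightarrow> decides f P m ?\<alpha> n v"
    proof
      assume "decides f P m ?\<alpha> n v"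
      then obtain d i r where r: "r < 2 ^ ((2 * i + 1) * 2 ^ n)"
        "eval (extend_oracle P m ?\<alpha> d) f [2 ^ ((2 * i + 1) * 2 ^ n) + r] v"
        unfolding decides_def by blast
      then obtain u where u: "eval (extend_oracle P m ?\<alpha> (d |` (dom ?\<alpha> \<inter> {..<u}))) f
          [2 ^ ((2 * i + 1) * 2 ^ n) + r] v"
        using eventually_happens'[OF sequentially_bot extend_oracle_use[OF r(2)]] by blast
      obtain c where "decode_delays c = d |` (dom ?\<alpha> \<inter> {..<u})"
        using decode_delays_surj[of "d |` (dom ?\<alpha> \<inter> {..<u})" u] by auto
      then show "\<exists>c i r. r < 2 ^ ((2 * i + 1) * 2 ^ n) \<and>
          eval (extend_oracle P m ?\<alpha> (decode_delays c)) f [2 ^ ((2 * i + 1) * 2 ^ n) + r] v"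
        using r(1) u by metis
    qed (auto simp: decides_def)
    finally show ?thesis by simp
  qed
  ultimately show ?thesis by blast
qed

text \<open>A conflict is confirmed by finding the replacement \<open>g\<close>, the argument
  \<open>n\<close> and witnesses for two halting computations with different values. These are the
  sets to which genericity is applied.\<close>

lemma Sigma01_conflict:
  assumes "finite P" and E: "\<And>k F. recursive k F \<Longrightarrow> decidable k (\<lambda>xs. E (F xs))"
  shows "Sigma01_strings {\<sigma>. \<exists>g n v w. v \<noteq> w \<and> decides f P m (string_map \<sigma>) n w \<and>
    decides f P m (merge E (string_map \<sigma>) (decode_bits g)) n v}"
proof -
  obtain p where p: "\<And>k F1 F2 F3 F4. recursive k F1 \<Longrightarrow> recursive k F2 \<Longrightarrow> recursive k F3 \<Longrightarrow>
        recursive k F4 \<Longrightarrow> recursive k (\<lambda>xs. p (F1 xs) (F2 xs) (F3 xs) (F4 xs))"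
    "\<And>s g n v. decides f P m (merge E (decode_bits s) (decode_bits g)) n v \<longleftrightarrow>
        (\<exists>h. p s g n h = Suc v)"
    using decides_merge_Sigma01[where E = E, OF assms, of f m] by blast
  \<comment> \<open>With nothing replaced, the second string is ignored, and 0 can serve as its
    code.\<close>
  obtain p' where p': "\<And>k F1 F2 F3 F4. recursive k F1 \<Longrightarrow> recursive k F2 \<Longrightarrow> recursive k F3 \<Longrightarrow>
        recursive k F4 \<Longrightarrow> recursive k (\<lambda>xs. p' (F1 xs) (F2 xs) (F3 xs) (F4 xs))"
    "\<And>s g n v. decides f P m (merge (\<lambda>_. False) (decode_bits s) (decode_bits g)) n v \<longleftrightarrow>
        (\<exists>h. p' s g n h = Suc v)"
    using decides_merge_Sigma01[where E = "\<lambda>_. False", OF assms(1) decidable_const, of f m] by blast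
  have p'_iff: "decides f P m (decode_bits s) n w \<longleftrightarrow> (\<exists>h. p' s 0 n h = Suc w)" for s n w
    using p'(2)[of s 0 n w] by (simp add: merge_def[abs_def])
  define R where "R s y = (let g = fst (prod_decode y); y1 = snd (prod_decode y);
      n = fst (prod_decode y1); y2 = snd (prod_decode y1);
      a = p s g n (fst (prod_decode y2)); b = p' s 0 n (snd (prod_decode y2)) in
      a \<noteq> 0 \<and> b \<noteq> 0 \<and> a \<noteq> b)" for s y
  have "decidable 2 (\<lambda>xs. R (xs ! 0) (xs ! 1))"
    unfolding R_def Let_def by (intro recursive_pair_intros p p') auto
  moreover have "(\<exists>y. R s y) \<longleftrightarrow> (\<exists>g n v w. v \<noteq> w \<and> decides f P m (decode_bits s) n w \<and>
    decides f P m (merge E (decode_bits s) (decode_bits g)) n v)" for s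
  proof
    assume "\<exists>y. R s y"
    then obtain g n h h' where "p s g n h \<noteq> 0" "p' s 0 n h' \<noteq> 0" "p s g n h \<noteq> p' s 0 n h'"
      unfolding R_def Let_def by blast
    then obtain v w where "p s g n h = Suc v" "p' s 0 n h' = Suc w" "v \<noteq> w"
      by (metis not0_implies_Suc)
    then show "\<exists>g n v w. v \<noteq> w \<and> decides f P m (decode_bits s) n w \<and>
        decides f P m (merge E (decode_bits s) (decode_bits g)) n v"
      unfolding p(2) p'_iff by blast
  next
    assume "\<exists>g n v w. v \<noteq> w \<and> decides f P m (decode_bits s) n w \<and>
        decides f P m (merge E (decode_bits s) (decode_bits g)) n v"
    then obtain g n v w h h' where "v \<noteq> w" "p s g n h = Suc v" "p' s 0 n h' = Suc w"
      unfolding p(2) p'_iff by blast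
    then have "R s (prod_encode (g, prod_encode (n, prod_encode (h, h'))))"
      by (simp add: R_def)
    then show "\<exists>y. R s y" ..
  qed
  ultimately show ?thesis
    using Sigma01_strings_decidable[of R] by simp
qed

text \<open>A generic real cannot be changed on \<open>j + 1\<close> residue classes so that a wrong value is decided:
  otherwise the change in the last class alone, with the remaining ones undone, would yield a string
  close to \<open>A\<close> that decides two different values, because the right value is decided without the
  last class.\<close>

lemma generic_robust_computable:
  assumes gen: "one_generic A" and "finite P" and "0 < M"
    and correct: "\<And>n v. decides f P m (\<lambda>x. Some (x \<in> A)) n v \<Longrightarrow> v = chi B n"
    and robust: "\<And>j n L. j < M \<Longrightarrow>
      decides f P m (\<lambda>x. if m \<le> x \<and> x < L \<and> x mod M = j then None else Some (x \<in> A)) n (chi B n)"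
  shows "computable B"
proof -
  \<comment> \<open>Beyond \<open>k\<close> the classes below \<open>j\<close> may carry arbitrary
    bits, and positions may be undefined anywhere; still no wrong value is decided.\<close>
  have claim: "\<exists>k\<ge>m. \<forall>\<alpha> n v. (\<forall>x b. \<alpha> x = Some b \<longrightarrow> k \<le> x \<and> x mod M < j \<or> b = (x \<in> A)) \<longrightarrow>
      decides f P m \<alpha> n v \<longrightarrow> v = chi B n" if "j \<le> M" for j
    using that
  proof (induction j)
    case 0
    have "v = chi B n" if "\<forall>x b. \<alpha> x = Some b \<longrightarrow> b = (x \<in> A)" "decides f P m \<alpha> n v" for \<alpha> n v
      using that by (intro correct decides_mono[OF that(2)]) auto
    then show ?case by auto
  next
    case (Suc j)
    then obtain k where "m \<le> k" and k: "\<forall>\<alpha> n v.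
        (\<forall>x b. \<alpha> x = Some b \<longrightarrow> k \<le> x \<and> x mod M < j \<or> b = (x \<in> A)) \<longrightarrow>
        decides f P m \<alpha> n v \<longrightarrow> v = chi B n"
      using Suc_leD by blast
    note IH = k[rule_format]
    define E where "E x \<longleftrightarrow> k \<le> x \<and> x mod M < j" for x
    define S where "S = {\<sigma>. \<exists>g n v w. v \<noteq> w \<and> decides f P m (string_map \<sigma>) n w \<and>
      decides f P m (merge E (string_map \<sigma>) (decode_bits g)) n v}"
    have "Sigma01_strings S"
      unfolding S_def E_def using \<open>finite P\<close> \<open>0 < M\<close>
      by (intro Sigma01_conflict) (auto intro!: recursive_intros)
    \<comment> \<open>By the induction hypothesis, both conflicting values would equal
      \<open>chi B n\<close>.\<close>
    moreover have "initial_segment A l \<notin> S" for l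
    proof
      assume "initial_segment A l \<in> S"
      then obtain g n v w where "v \<noteq> w" and w: "decides f P m (string_map (initial_segment A l)) n w"
        and v: "decides f P m (merge E (string_map (initial_segment A l)) (decode_bits g)) n v"
        unfolding S_def by blast
      have "v = chi B n"
        by (rule IH[OF _ v]) (auto simp: merge_def E_def string_map_initial_segment split: if_splits)
      moreover have "w = chi B n"
        by (rule IH[OF _ w]) (auto simp: string_map_initial_segment split: if_splits)
      ultimately show False using \<open>v \<noteq> w\<close> by simp
    qed
    ultimately obtain l where l: "\<And>\<tau>. prefix (initial_segment A l) \<tau> \<Longrightarrow> \<tau> \<notin> S"
      using gen unfolding one_generic_def by blast
    define k' where "k' = max k l"
    have "v = chi B n" if \<alpha>: "\<forall>x b. \<alpha> x = Some b \<longrightarrow> k' \<le> x \<and> x mod M < Suc j \<or> b = (x \<in> A)"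
      and v: "decides f P m \<alpha> n v" for \<alpha> n v
    proof (rule ccontr)
      assume neq: "v \<noteq> chi B n"
      obtain u where u: "\<And>\<beta>. (\<And>x b. x < u \<Longrightarrow> \<alpha> x = Some b \<Longrightarrow> \<beta> x = Some b) \<Longrightarrow>
          decides f P m \<beta> n v"
        using eventually_happens'[OF sequentially_bot decides_use[OF v]] by blast
      \<comment> \<open>Of the changes in \<open>\<alpha>\<close>, only those in class
        \<open>j\<close> below \<open>u\<close> are kept; undefined positions there become
        \<open>False\<close>.\<close>
      define \<rho> where "\<rho> x \<longleftrightarrow> (if k' \<le> x \<and> x < u \<and> x mod M = j then \<alpha> x = Some True else x \<in> A)" for x
      \<comment> \<open>All changes lie in class \<open>j\<close> between \<open>m\<close> and
        \<open>u\<close>, which is the part that \<open>robust\<close> allows to be hidden.\<close>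
      have "decides f P m (\<lambda>x. Some (\<rho> x)) n (chi B n)"
      proof (rule decides_mono[OF robust])
        show "j < M" using Suc.prems by simp
        show "Some (\<rho> x) = Some b"
          if "(if m \<le> x \<and> x < u \<and> x mod M = j then None else Some (x \<in> A)) = Some b" for x b
          using that \<open>m \<le> k\<close> by (auto simp: \<rho>_def k'_def split: if_splits)
      qed
      from eventually_happens'[OF sequentially_bot
          eventually_conj[OF eventually_ge_at_top[of "max u k'"] decides_use[OF this]]]
      obtain u' where "max u k' \<le> u'"
        and u': "\<And>\<beta>. (\<And>x. x < u' \<Longrightarrow> \<beta> x = Some (\<rho> x)) \<Longrightarrow> decides f P m \<beta> n (chi B n)"
        by auto
      define \<sigma> where "\<sigma> = map \<rho> [0..<u']"
      have \<sigma>: "string_map \<sigma> x = Some (\<rho> x)" if "x < u'" for x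
        using that by (simp add: \<sigma>_def string_map_def)
      have "decides f P m (string_map \<sigma>) n (chi B n)"
        by (rule u') (rule \<sigma>)
      \<comment> \<open>Putting back the changes in the classes below \<open>j\<close> recovers
        \<open>\<alpha>\<close> below \<open>u\<close>, hence the wrong value
        \<open>v\<close>.\<close>
      moreover have "decides f P m (merge E (string_map \<sigma>)
          (decode_bits (string_code (map (\<lambda>x. \<alpha> x = Some True) [0..<u])))) n v"
      proof (rule u)
        fix x b assume x: "x < u" "\<alpha> x = Some b"
        show "merge E (string_map \<sigma>)
            (decode_bits (string_code (map (\<lambda>x. \<alpha> x = Some True) [0..<u]))) x = Some b"
        proof (cases "E x")
          case True
          then show ?thesis using x by (simp add: merge_def string_map_def)
        next
          case False
          then have "\<not> (k' \<le> x \<and> x mod M < j)" by (auto simp: E_def k'_def)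
          then have "\<rho> x = b"
            using \<alpha>[rule_format, OF x(2)] x by (auto simp: \<rho>_def less_Suc_eq)
          then show ?thesis
            using False \<sigma>[of x] x(1) \<open>max u k' \<le> u'\<close> by (simp add: merge_def)
        qed
      qed
      ultimately have "\<sigma> \<in> S"
        unfolding S_def using neq by blast
      moreover have "prefix (initial_segment A l) \<sigma>"
        using \<open>max u k' \<le> u'\<close>
        by (intro prefix_initial_segmentI) (auto simp: \<sigma>_def \<rho>_def k'_def)
      ultimately show False using l by blast
    qed
    moreover have "m \<le> k'" using \<open>m \<le> k\<close> by (simp add: k'_def)
    ultimately show ?case by blast
  qed
  \<comment> \<open>For \<open>j = M\<close> the residue condition always holds, so all bits beyond
    \<open>k\<close> are arbitrary.\<close>
  obtain k where "\<forall>\<alpha> n v. (\<forall>x b. \<alpha> x = Some b \<longrightarrow> k \<le> x \<and> x mod M < M \<or> b = (x \<in> A)) \<longrightarrow>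
      decides f P m \<alpha> n v \<longrightarrow> v = chi B n"
    using claim[of M] by blast
  with \<open>0 < M\<close> have k: "\<forall>\<alpha> n v. (\<forall>x b. \<alpha> x = Some b \<longrightarrow> k \<le> x \<or> b = (x \<in> A)) \<longrightarrow>
      decides f P m \<alpha> n v \<longrightarrow> v = chi B n"
    by simp
  have le: "decidable j (\<lambda>xs. k \<le> F xs)" if "recursive j F" for j F
    by (intro recursive_intros that)
  obtain p where p: "\<And>j F1 F2 F3 F4. recursive j F1 \<Longrightarrow> recursive j F2 \<Longrightarrow> recursive j F3 \<Longrightarrow>
        recursive j F4 \<Longrightarrow> recursive j (\<lambda>xs. p (F1 xs) (F2 xs) (F3 xs) (F4 xs))"
    "\<And>s g n v. decides f P m (merge ((\<le>) k) (decode_bits s) (decode_bits g)) n v \<longleftrightarrow>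
        (\<exists>h. p s g n h = Suc v)"
    using decides_merge_Sigma01[where E = "(\<le>) k", OF \<open>finite P\<close> le, of f m] by blast
  define s where "s = string_code (initial_segment A k)"
  have dec_iff: "(\<exists>h. p s g n h = Suc v) \<longleftrightarrow>
      decides f P m (merge ((\<le>) k) (string_map (initial_segment A k)) (decode_bits g)) n v"
    for g n v
    using p(2)[of s g n v] by (simp add: s_def)
  show ?thesis
  \<comment> \<open>The search runs over a string code for the bits from \<open>k\<close> on, paired
    with a halting witness; the finite initial segment of \<open>A\<close> is built into the
    program.\<close>
  proof (rule computable_by_search)
    show "recursive 2 (\<lambda>xs. p s (fst (prod_decode (xs ! 1))) (xs ! 0) (snd (prod_decode (xs ! 1))))"
      by (intro p recursive_pair_intros) auto
    show "\<exists>y. p s (fst (prod_decode y)) n (snd (prod_decode y)) \<noteq> 0" for n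
    proof -
      \<comment> \<open>The bound \<open>L = 0\<close> hides nothing.\<close>
      have "decides f P m (\<lambda>x. Some (x \<in> A)) n (chi B n)"
        using robust[OF \<open>0 < M\<close>, of 0 n]
        by (rule decides_mono) (auto split: if_splits)
      from eventually_happens'[OF sequentially_bot decides_use[OF this]]
      obtain u where u: "\<And>\<beta>. (\<And>x. x < u \<Longrightarrow> \<beta> x = Some (x \<in> A)) \<Longrightarrow>
          decides f P m \<beta> n (chi B n)"
        by auto
      have "decides f P m (merge ((\<le>) k) (string_map (initial_segment A k))
          (decode_bits (string_code (initial_segment A u)))) n (chi B n)"
        by (rule u) (simp add: merge_def string_map_initial_segment)
      then obtain h where "p s (string_code (initial_segment A u)) n h = Suc (chi B n)"
        unfolding dec_iff[symmetric] by blast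
      then show ?thesis
        by (intro exI[of _ "prod_encode (string_code (initial_segment A u), h)"]) simp
    qed
    show "p s (fst (prod_decode y)) n (snd (prod_decode y)) = Suc (chi B n)"
      if nz: "p s (fst (prod_decode y)) n (snd (prod_decode y)) \<noteq> 0" for n y
    proof -
      obtain v where v: "p s (fst (prod_decode y)) n (snd (prod_decode y)) = Suc v"
        using not0_implies_Suc[OF nz] by blast
      then have "decides f P m (merge ((\<le>) k) (string_map (initial_segment A k))
          (decode_bits (fst (prod_decode y)))) n v"
        unfolding dec_iff[symmetric] by blast
      then have "v = chi B n"
        by (rule k[rule_format, rotated]) (auto simp: merge_def string_map_initial_segment split: if_splits)
      then show ?thesis using v by simp
    qed
  qed
qed

section \<open>Hiding a residue class to defeat one functional\<close>

lemma triples_code_iff [simp]: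
  "prod_encode (x, prod_encode (c, l)) \<in> triples_code Q \<longleftrightarrow> (x, c, l) \<in> Q"
  by (auto simp: triples_code_def)

lemma partial_oracle_value: "partial_oracle A Q \<Longrightarrow> (x, c, l) \<in> Q \<Longrightarrow> c = chi A x"
  unfolding partial_oracle_def by metis

lemma partial_oracle_delay:
  "partial_oracle A Q \<Longrightarrow> (x, c, l) \<in> Q \<Longrightarrow> (x, c, l') \<in> Q \<Longrightarrow> l = l'"
  unfolding partial_oracle_def by metis

lemma set_eqI_triple_codes:
  assumes "\<And>x c l. prod_encode (x, prod_encode (c, l)) \<in> X \<longleftrightarrow> prod_encode (x, prod_encode (c, l)) \<in> Y"
  shows "X = Y"
proof (rule set_eqI)
  fix z
  obtain x c l where "z = prod_encode (x, prod_encode (c, l))"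
    by (metis prod_decode_inverse surj_pair)
  then show "z \<in> X \<longleftrightarrow> z \<in> Y" using assms by simp
qed

text \<open>Below \<open>m\<close> absences are fixed along with triples, so oracle answers about
  these positions can no longer change.\<close>

definition freezes :: "(nat \<times> nat \<times> nat) set \<Rightarrow> nat \<Rightarrow> (nat \<times> nat \<times> nat) set \<Rightarrow> bool" where
  "freezes T m Q \<longleftrightarrow> T \<subseteq> Q \<and> (\<forall>x c l. (x, c, l) \<in> Q \<longrightarrow> x < m \<longrightarrow> (x, c, l) \<in> T)"

definition condition :: "nat set \<Rightarrow> (nat \<times> nat \<times> nat) set \<Rightarrow> nat \<Rightarrow> bool" where
  "condition A T m \<longleftrightarrow> finite T \<and> partial_oracle A T \<and> oracle_dom T \<subseteq> {..<m}"

lemma freezes_trans: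
  assumes "freezes T m T'" "freezes T' m' Q" "m \<le> m'"
  shows "freezes T m Q"
  using assms unfolding freezes_def by (meson less_le_trans order_trans)

lemma condition_extend:
  fixes d :: "nat \<Rightarrow> nat"
  assumes "condition A T m" "m \<le> m'" and "T' = T \<union> {(x, chi A x, d x) | x. m \<le> x \<and> x < m' \<and> Q x}"
  shows "condition A T' m'" "freezes T m T'"
proof -
  have T: "x < m" if "(x, c, l) \<in> T" for x c l
    using assms(1) that unfolding condition_def oracle_dom_def by blast
  have "{(x, chi A x, d x) | x. m \<le> x \<and> x < m' \<and> Q x} \<subseteq> (\<lambda>x. (x, chi A x, d x)) ` {..<m'}"
    by auto
  then have "finite T'"
    using assms(1) unfolding assms(3) condition_def by (auto intro: finite_subset)
  moreover have "partial_oracle A T'"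
    using assms(1) T unfolding assms(3) condition_def partial_oracle_def
    by (auto simp: chi_def dest: leD)
  moreover have "oracle_dom T' \<subseteq> {..<m'}"
    using T \<open>m \<le> m'\<close> unfolding assms(3) oracle_dom_def by fastforce
  ultimately show "condition A T' m'"
    by (simp add: condition_def)
  show "freezes T m T'"
    unfolding assms(3) freezes_def by auto
qed

text \<open>Either a wrong value is decided by some extension, whose relevant part is then frozen,
  or robustness fails and a class is hidden so that the right value cannot be decided.
  \<open>N\<close> aligns the new boundary; \<open>M\<close> controls how sparse the hidden class
  is.\<close>

lemma defeat_functional:
  assumes gen: "one_generic A" and B: "\<not> computable B" and cond: "condition A T m"
    and "0 < M" "0 < N"
  shows "\<exists>T' m' j. condition A T' m' \<and> m < m' \<and> N dvd m' \<and> freezes T m T' \<and>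
    (\<forall>x. m \<le> x \<and> x < m' \<and> x mod M \<noteq> j \<longrightarrow> x \<in> oracle_dom T') \<and>
    (\<forall>Q. partial_oracle A Q \<longrightarrow> freezes T' m' Q \<longrightarrow>
      \<not> generic_computation (functional f (triples_code Q)) (RR_tilde (RR B)))"
proof -
  define P where "P = triples_code T"
  have "triples_code T = (\<lambda>(x, c, l). prod_encode (x, prod_encode (c, l))) ` T"
    by (force simp: triples_code_def)
  then have "finite P"
    using cond unfolding condition_def P_def by simp
  have T: "x < m" if "(x, c, l) \<in> T" for x c l
    using cond that unfolding condition_def oracle_dom_def by blast
  have correct: "v = chi B n"
    if "generic_computation (functional f (triples_code Q)) (RR_tilde (RR B))"
      "eval (triples_code Q) f [2 ^ ((2 * i + 1) * 2 ^ n) + r] v" "r < 2 ^ ((2 * i + 1) * 2 ^ n)"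
    for Q n i r v
  proof -
    have "v = chi (RR_tilde (RR B)) (2 ^ ((2 * i + 1) * 2 ^ n) + r)"
      using that(1,2) unfolding generic_computation_def functional_eq_Some_iff by blast
    then show ?thesis
      unfolding chi_def RR_tilde_RR_iff[OF refl that(3)] .
  qed
  show ?thesis
  proof (cases "\<exists>n v. decides f P m (\<lambda>x. Some (x \<in> A)) n v \<and> v \<noteq> chi B n")
    case True
    then obtain n v d i r where "v \<noteq> chi B n" and r: "r < 2 ^ ((2 * i + 1) * 2 ^ n)"
      and v: "eval (extend_oracle P m (\<lambda>x. Some (x \<in> A)) d) f [2 ^ ((2 * i + 1) * 2 ^ n) + r] v"
      unfolding decides_def by blast
    obtain u where u: "\<And>Y. (\<And>z. z < u \<Longrightarrow>
        z \<in> Y \<longleftrightarrow> z \<in> extend_oracle P m (\<lambda>x. Some (x \<in> A)) d) \<Longrightarrow>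
        eval Y f [2 ^ ((2 * i + 1) * 2 ^ n) + r] v"
      using eventually_happens'[OF sequentially_bot eval_use[OF v]] by blast
    define m' where "m' = N * (max u m + 1)"
    have "1 * (max u m + 1) \<le> m'"
      unfolding m'_def using \<open>0 < N\<close> by (intro mult_le_mono1) simp
    then have m': "u \<le> m'" "m < m'" "N dvd m'" by (auto simp: m'_def)
    \<comment> \<open>Positions that \<open>d\<close> leaves unrevealed get delay \<open>u\<close>.
      Their codes are then at least \<open>u\<close>, so the domain has no gaps while the oracle
      below \<open>u\<close> stays the same.\<close>
    define T' where "T' = T \<union> {(x, chi A x, case d x of None \<Rightarrow> u | Some l \<Rightarrow> l) | x.
      m \<le> x \<and> x < m' \<and> True}"
    note T' = condition_extend[OF cond less_imp_le[OF m'(2)] T'_def]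
    have "\<not> generic_computation (functional f (triples_code Q)) (RR_tilde (RR B))"
      if "freezes T' m' Q" for Q
    proof
      assume gc: "generic_computation (functional f (triples_code Q)) (RR_tilde (RR B))"
      have "eval (triples_code Q) f [2 ^ ((2 * i + 1) * 2 ^ n) + r] v"
      proof (rule u)
        fix z assume "z < u"
        obtain x c l where z: "z = prod_encode (x, prod_encode (c, l))"
          by (metis prod_decode_inverse surj_pair)
        have "x < u" "l < u"
          using \<open>z < u\<close> le_prod_encode_1[of x "prod_encode (c, l)"]
            le_prod_encode_2[of "prod_encode (c, l)" x] le_prod_encode_2[of l c] z by auto
        then have "z \<in> triples_code Q \<longleftrightarrow> (x, c, l) \<in> T'"
          using \<open>freezes T' m' Q\<close> m' unfolding z freezes_def by auto
        also have "\<dots> \<longleftrightarrow> z \<in> extend_oracle P m (\<lambda>x. Some (x \<in> A)) d"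
          using \<open>x < u\<close> \<open>l < u\<close> m'
          unfolding z T'_def P_def extend_oracle_def
          by (auto simp: chi_def split: option.splits)
        finally show "z \<in> triples_code Q \<longleftrightarrow> z \<in> extend_oracle P m (\<lambda>x. Some (x \<in> A)) d" .
      qed
      with correct[OF gc _ r] \<open>v \<noteq> chi B n\<close> show False by blast
    qed
    moreover have "x \<in> oracle_dom T'" if "m \<le> x" "x < m'" for x
      using that unfolding T'_def oracle_dom_def by blast
    ultimately show ?thesis using T' m' by blast
  next
    case False
    then obtain j n L where "j < M" and not_dec: "\<not> decides f P m
        (\<lambda>x. if m \<le> x \<and> x < L \<and> x mod M = j then None else Some (x \<in> A)) n (chi B n)"
        (is "\<not> decides f P m ?\<gamma> _ _")
      using generic_robust_computable[OF gen \<open>finite P\<close> \<open>0 < M\<close>, of f m B] B by blast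
    define m' where "m' = N * (max L m + 1)"
    have "1 * (max L m + 1) \<le> m'"
      unfolding m'_def using \<open>0 < N\<close> by (intro mult_le_mono1) simp
    then have m': "L \<le> m'" "m < m'" "N dvd m'" by (auto simp: m'_def)
    define T' where "T' = T \<union> {(x, chi A x, (\<lambda>_. 0) x) | x. m \<le> x \<and> x < m' \<and> x mod M \<noteq> j}"
    note T' = condition_extend[OF cond less_imp_le[OF m'(2)] T'_def]
    have "\<not> generic_computation (functional f (triples_code Q)) (RR_tilde (RR B))"
      if Q: "partial_oracle A Q" "freezes T' m' Q" for Q
    proof
      assume gc: "generic_computation (functional f (triples_code Q)) (RR_tilde (RR B))"
      then obtain K where K: "\<And>k. K \<le> k \<Longrightarrow>
          \<exists>x\<in>dom (functional f (triples_code Q)). 2 ^ k \<le> x \<and> x < 2 ^ (k + 1)"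
        unfolding generic_computation_def using density_1_meets_dyadic by blast
      \<comment> \<open>This block codes \<open>n\<close>, and \<open>K \<le> k\<close> ensures that
        the density-1 domain meets it.\<close>
      define k where "k = (2 * K + 1) * 2 ^ n"
      have "(2 * K + 1) * 1 \<le> k" unfolding k_def by (intro mult_le_mono2) simp
      then obtain x v where x: "2 ^ k \<le> x" "x < 2 ^ (k + 1)" and v: "eval (triples_code Q) f [x] v"
        using K[of k] by (auto simp: functional_eq_Some_iff)
      define r where "r = x - 2 ^ k"
      have r: "x = 2 ^ k + r" "r < 2 ^ k"
        using x by (auto simp: r_def)
      have "v = chi B n"
        using correct[OF gc] v r unfolding k_def by blast
      \<comment> \<open>The delays are read off \<open>Q\<close>, where they are unique.\<close>
      define d where "d x = (if x \<in> oracle_dom Q then Some (THE l. (x, chi A x, l) \<in> Q) else None)" for x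
      have d: "d x = Some l \<longleftrightarrow> (x, chi A x, l) \<in> Q" for x l
      proof
        assume "(x, chi A x, l) \<in> Q"
        moreover from this have "(THE l. (x, chi A x, l) \<in> Q) = l"
          using partial_oracle_delay[OF Q(1)] by blast
        ultimately show "d x = Some l"
          by (auto simp: d_def oracle_dom_def)
      next
        assume "d x = Some l"
        then have "x \<in> oracle_dom Q" and l: "(THE l. (x, chi A x, l) \<in> Q) = l"
          by (auto simp: d_def split: if_splits)
        then obtain c l' where xcl: "(x, c, l') \<in> Q"
          unfolding oracle_dom_def by blast
        with partial_oracle_value[OF Q(1) xcl] have l': "(x, chi A x, l') \<in> Q" by simp
        have "(THE l. (x, chi A x, l) \<in> Q) = l'"
          using l' partial_oracle_delay[OF Q(1)] by blast
        with l l' show "(x, chi A x, l) \<in> Q" by simp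
      qed
      \<comment> \<open>Since \<open>Q\<close> adds nothing to \<open>T'\<close> below
        \<open>m'\<close> and \<open>L \<le> m'\<close>, it reveals no position hidden in
        \<open>?\<gamma>\<close>.\<close>
      have eq: "triples_code Q = extend_oracle P m ?\<gamma> d"
      proof (rule set_eqI_triple_codes)
        fix x c l
        have "(x, c, l) \<in> Q \<longleftrightarrow> (x, c, l) \<in> T \<or>
            (m \<le> x \<and> c = chi A x \<and> ?\<gamma> x \<noteq> None \<and> (x, chi A x, l) \<in> Q)"
        proof
          assume xcl: "(x, c, l) \<in> Q"
          have T'_iff: "(x, c, l) \<in> T'" if "x < m'"
            using Q(2) xcl that unfolding freezes_def by blast
          show "(x, c, l) \<in> T \<or> (m \<le> x \<and> c = chi A x \<and> ?\<gamma> x \<noteq> None \<and> (x, chi A x, l) \<in> Q)"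
          proof (cases "(x, c, l) \<in> T")
            case False
            then have "m' \<le> x \<or> (m \<le> x \<and> x mod M \<noteq> j)"
              using T'_iff unfolding T'_def by fastforce
            then show ?thesis
              using xcl partial_oracle_value[OF Q(1) xcl] m' by auto
          qed simp
        next
          show "(x, c, l) \<in> Q" if "(x, c, l) \<in> T \<or>
              (m \<le> x \<and> c = chi A x \<and> ?\<gamma> x \<noteq> None \<and> (x, chi A x, l) \<in> Q)"
            using that Q(2) unfolding freezes_def T'_def by auto
        qed
        then show "prod_encode (x, prod_encode (c, l)) \<in> triples_code Q \<longleftrightarrow>
            prod_encode (x, prod_encode (c, l)) \<in> extend_oracle P m ?\<gamma> d"
          unfolding extend_oracle_def P_def using d
          by (auto simp: chi_def split: if_splits)
      qed
      have "decides f P m ?\<gamma> n v"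
        using v r(2) unfolding decides_def eq r(1) k_def by blast
      with \<open>v = chi B n\<close> not_dec show False by simp
    qed
    moreover have "x \<in> oracle_dom T'" if "m \<le> x" "x < m'" "x mod M \<noteq> j" for x
      using that unfolding T'_def oracle_dom_def by blast
    ultimately show ?thesis using T' m' by blast
  qed
qed

section \<open>Construction of the generic oracle in stages\<close>

instance recfun :: countable
  by countable_datatype

text \<open>Stage \<open>e\<close> hides at most one class modulo \<open>2 ^ e\<close> and defeats
  the program with index \<open>e\<close>. The union of the finite conditions freezes every stage
  and so inherits all defeats.\<close>

lemma one_generic_not_above_noncomputable:
  assumes gen: "one_generic A" and B: "\<not> computable B"
  shows "\<not> RR_tilde (RR B) \<le>\<^sub>n\<^sub>g A"
proof -
  define defeated where "defeated T m f \<longleftrightarrow> (\<forall>Q. partial_oracle A Q \<longrightarrow> freezes T m Q \<longrightarrow>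
      \<not> generic_computation (functional f (triples_code Q)) (RR_tilde (RR B)))" for T m f
  define next_stage where "next_stage e s s' \<longleftrightarrow>
      snd s < snd s' \<and> freezes (fst s) (snd s) (fst s') \<and>
      (\<exists>j. \<forall>x. snd s \<le> x \<and> x < snd s' \<and> x mod 2 ^ e \<noteq> j \<longrightarrow> x \<in> oracle_dom (fst s')) \<and>
      defeated (fst s') (snd s') (from_nat e)" for e and s s' :: "(nat \<times> nat \<times> nat) set \<times> nat"
  have "\<exists>S. \<forall>e. (condition A (fst (S e)) (snd (S e)) \<and> 2 ^ e dvd snd (S e)) \<and>
      next_stage e (S e) (S (Suc e))"
  proof (rule dependent_nat_choice)
    show "\<exists>s. condition A (fst s) (snd s) \<and> 2 ^ 0 dvd snd s"
      by (rule exI[of _ "({}, 0)"]) (simp add: condition_def partial_oracle_def oracle_dom_def)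
    fix s e assume "condition A (fst s) (snd s) \<and> 2 ^ e dvd snd s"
    then have "condition A (fst s) (snd s)" ..
    from defeat_functional[OF gen B this, of "2 ^ e" "2 ^ Suc e" "from_nat e"]
    obtain T' m' j where "condition A T' m'" "snd s < m'" "2 ^ Suc e dvd m'"
      "freezes (fst s) (snd s) T'"
      "\<forall>x. snd s \<le> x \<and> x < m' \<and> x mod 2 ^ e \<noteq> j \<longrightarrow> x \<in> oracle_dom T'"
      "defeated T' m' (from_nat e)"
      unfolding defeated_def by (metis pos2 zero_less_power)
    then show "\<exists>s'. (condition A (fst s') (snd s') \<and> 2 ^ Suc e dvd snd s') \<and> next_stage e s s'"
      unfolding next_stage_def by (intro exI[of _ "(T', m')"]) auto
  qed
  then obtain S where S: "\<And>e. condition A (fst (S e)) (snd (S e))" "\<And>e. 2 ^ e dvd snd (S e)"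
    "\<And>e. next_stage e (S e) (S (Suc e))"
    by blast
  define T where "T e = fst (S e)" for e
  define m where "m e = snd (S e)" for e
  note stage = S(3)[unfolded next_stage_def, folded T_def m_def]
  have cond: "condition A (T e) (m e)" for e
    using S(1) by (simp add: T_def m_def)
  have "strict_mono m"
    using stage by (simp add: strict_mono_Suc_iff)
  have freeze: "freezes (T e) (m e) (T e')" if "e \<le> e'" for e e'
    using that
  proof (induction rule: dec_induct)
    case base
    show ?case by (simp add: freezes_def)
  next
    case (step i)
    show ?case
    proof (rule freezes_trans[OF step.IH])
      show "freezes (T i) (m i) (T (Suc i))" using stage by blast
      show "m e \<le> m i" using \<open>strict_mono m\<close> step.hyps by (simp add: strict_mono_less_eq)
    qed
  qed
  define P where "P = (\<Union>e. T e)"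
  \<comment> \<open>A triple below \<open>m e\<close> that enters at a later stage would violate the
    freezing between the two stages.\<close>
  have freeze_P: "freezes (T e) (m e) P" for e
    unfolding freezes_def
  proof (intro conjI allI impI)
    show "T e \<subseteq> P" by (auto simp: P_def)
    fix x c l assume "(x, c, l) \<in> P" "x < m e"
    then obtain e' where e': "(x, c, l) \<in> T e'" by (auto simp: P_def)
    show "(x, c, l) \<in> T e"
      using freeze[of e e'] freeze[of e' e] e' \<open>x < m e\<close> unfolding freezes_def
      by (meson nle_le subsetD)
  qed
  have po: "partial_oracle A P"
  proof -
    have po_T: "partial_oracle A (T e)" for e using cond by (simp add: condition_def)
    have both: "\<exists>e. t \<in> T e \<and> t' \<in> T e" if "t \<in> P" "t' \<in> P" for t t'
    proof -
      obtain e e' where "t \<in> T e" "t' \<in> T e'" using \<open>t \<in> P\<close> \<open>t' \<in> P\<close> by (auto simp: P_def)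
      then show ?thesis
        using freeze[of e "max e e'"] freeze[of e' "max e e'"] unfolding freezes_def by auto
    qed
    show ?thesis
      unfolding partial_oracle_def
    proof (intro conjI allI impI)
      fix n x l assume "(n, x, l) \<in> P"
      then obtain e where "(n, x, l) \<in> T e" using both by blast
      then show "x \<in> {0, 1}" "chi A n = x"
        using po_T[of e] unfolding partial_oracle_def by blast+
    next
      fix n x l l' assume "(n, x, l) \<in> P" "(n, x, l') \<in> P"
      then obtain e where "(n, x, l) \<in> T e" "(n, x, l') \<in> T e" using both by blast
      then show "l = l'" by (rule partial_oracle_delay[OF po_T])
    qed
  qed
  have "density_1 (oracle_dom P)"
  proof (rule density_1_stages[OF \<open>strict_mono m\<close>])
    show "2 ^ e dvd m e" for e using S(2) by (simp add: m_def)
    fix e x y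
    assume x: "m e \<le> x" "x < m (Suc e)" "x \<notin> oracle_dom P"
      and y: "m e \<le> y" "y < m (Suc e)" "y \<notin> oracle_dom P"
    obtain j where j: "\<forall>x. m e \<le> x \<and> x < m (Suc e) \<and> x mod 2 ^ e \<noteq> j \<longrightarrow>
        x \<in> oracle_dom (T (Suc e))"
      using stage[of e] by blast
    have "oracle_dom (T (Suc e)) \<subseteq> oracle_dom P"
      by (auto simp: oracle_dom_def P_def)
    with j x y have "x mod 2 ^ e = j" "y mod 2 ^ e = j" by blast+
    then show "x mod 2 ^ e = y mod 2 ^ e" by simp
  qed
  with po have "generic_oracle A P" by (simp add: generic_oracle_def)
  \<comment> \<open>The stage with index \<open>to_nat f\<close> treats \<open>f\<close>, because
    \<open>from_nat\<close> inverts \<open>to_nat\<close>.\<close>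
  moreover have "\<not> generic_computation (functional f (triples_code P)) (RR_tilde (RR B))" for f
    using stage[of "to_nat f"] po freeze_P unfolding defeated_def by simp
  ultimately show ?thesis unfolding ng_reducible_def by blast
qed

theorem proposition6p8:
  fixes A :: "nat set"
  assumes "one_generic A"
  shows "ng_quasiminimal A"
  unfolding ng_quasiminimal_def
  using one_generic_not_generically_computable[OF assms]
    one_generic_not_above_noncomputable[OF assms] by blast

end
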